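(* Let $\mathcal{K}$ be a variety of S[I]RLs (i.e., either a variety of SRLs or a variety of SIRLs) such that every finitely subdirectly irreducible member of $\mathcal{K}$ has finite depth and is negatively generated. Then every $\mathcal{K}$-epimorphism is surjective, i.e., $\mathcal{K}$ has the ES property.
   Context: An SRL (commutative subidempotent residuated lattice) is an algebra $\mathbf{A}=\langle A;\wedge,\vee,\cdot,\to,e\rangle$ such that $\langle A;\wedge,\vee\rangle$ is a lattice (with order $\leqslant$), $\langle A;\cdot,e\rangle$ is a commutative monoid, $x\cdot y\leqslant z \iff x\leqslant y\to z$ for all $x,y,z$, and $x\leqslant e$ implies $x\cdot x=x$. An SIRL is an SRL expanded by a unary operation $\neg$ satisfying $\neg\neg x=x$ and $x\to\neg y=y\to\neg x$. The negative cone of an S[I]RL $\mathbf{A}$ is the Brouwerian algebra $\mathbf{A}^-=\langle A^-;\wedge,\vee,\to^-,e\rangle$ where $A^-=\{a\in A: a\leqslant e\}$ (with the restricted lattice operations) and $a\to^- b=(a\to b)\wedge e$. $\mathbf{A}$ is negatively generated if $A$ is generated, as an S[I]RL, by $A^-$. For a Brouwerian algebra $\mathbf{D}$ (an SRL with greatest element $e$), a prime filter is a nonempty subset $F$ that is upward closed, closed under $\wedge$, and whose complement is closed under $\vee$ (so $D$ itself counts as a prime filter); let $\mathrm{Pr}(\mathbf{D})$ be the set of prime filters ordered by inclusion. The depth of $F\in\mathrm{Pr}(\mathbf{D})$ is the largest $n$ such that there is a chain $F=F_0\subsetneq F_1\subsetneq\dots\subsetneq F_n=D$ in $\mathrm{Pr}(\mathbf{D})$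 (or $\infty$ if none exists); the depth of $\mathbf{D}$ is the supremum of the depths of its prime filters. The depth of an S[I]RL $\mathbf{A}$ is the depth of $\mathbf{A}^-$. An algebra is finitely subdirectly irreducible (FSI) if the identity relation is meet-irreducible in its congruence lattice. For a class $\mathcal{K}$, a $\mathcal{K}$-morphism is a homomorphism between members of $\mathcal{K}$; it is a $\mathcal{K}$-epimorphism $f:\mathbf{A}\to\mathbf{B}$ if for all $\mathcal{K}$-morphisms $g,h:\mathbf{B}\to\mathbf{C}$, $g\circ f=h\circ f$ implies $g=h$. $\mathcal{K}$ has the ES property if all $\mathcal{K}$-epimorphisms are surjective. *)

theory Defs
  imports Main "HOL-Library.Extended_Nat"
begin

text \<open>
  Universal algebra over a carrier type \<open>'u\<close>.  A signature maps each symbol to its arity, and a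
  symbol mapped to \<open>None\<close> is absent: its interpretation is never consulted.  Likewise the values
  of operations and homomorphisms outside the carriers are irrelevant.
\<close>

type_synonym 'f signature = "'f \<Rightarrow> nat option"

record ('f, 'u) algebra =
  carrier :: "'u set"
  opn :: "'f \<Rightarrow> 'u list \<Rightarrow> 'u"

definition subuniverse :: "'f signature \<Rightarrow> ('f, 'u) algebra \<Rightarrow> 'u set \<Rightarrow> bool" where
  "subuniverse S A B \<longleftrightarrow> B \<subseteq> carrier A \<and>
     (\<forall>f xs. S f = Some (length xs) \<and> set xs \<subseteq> B \<longrightarrow> opn A f xs \<in> B)"

definition is_algebra :: "'f signature \<Rightarrow> ('f, 'u) algebra \<Rightarrow> bool" where
  "is_algebra S A \<longleftrightarrow> carrier A \<noteq> {} \<and> subuniverse S A (carrier A)"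

definition generated :: "'f signature \<Rightarrow> ('f, 'u) algebra \<Rightarrow> 'u set \<Rightarrow> 'u set" where
  "generated S A X = \<Inter> {B. subuniverse S A B \<and> X \<subseteq> B}"

definition hom :: "'f signature \<Rightarrow> ('f, 'u) algebra \<Rightarrow> ('f, 'u) algebra \<Rightarrow> ('u \<Rightarrow> 'u) set" where
  "hom S A B = {h. h ` carrier A \<subseteq> carrier B \<and>
     (\<forall>f xs. S f = Some (length xs) \<and> set xs \<subseteq> carrier A \<longrightarrow>
        h (opn A f xs) = opn B f (map h xs))}"

definition congruence :: "'f signature \<Rightarrow> ('f, 'u) algebra \<Rightarrow> ('u \<times> 'u) set \<Rightarrow> bool" where
  "congruence S A \<theta> \<longleftrightarrow> equiv (carrier A) \<theta> \<and>
     (\<forall>f xs ys. S f = Some (length xs) \<and> list_all2 (\<lambda>x y. (x, y) \<in> \<theta>) xs ys \<longrightarrow>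
        (opn A f xs, opn A f ys) \<in> \<theta>)"

text \<open>Trivial algebras count as finitely subdirectly irreducible here.\<close>

definition FSI :: "'f signature \<Rightarrow> ('f, 'u) algebra \<Rightarrow> bool" where
  "FSI S A \<longleftrightarrow> (\<forall>\<theta> \<phi>. congruence S A \<theta> \<and> congruence S A \<phi> \<and> \<theta> \<inter> \<phi> = Id_on (carrier A) \<longrightarrow>
     \<theta> = Id_on (carrier A) \<or> \<phi> = Id_on (carrier A))"

datatype 'f uterm = Var nat | App 'f "'f uterm list"

fun wf_uterm :: "'f signature \<Rightarrow> 'f uterm \<Rightarrow> bool" where
  "wf_uterm S (Var i) \<longleftrightarrow> True"
| "wf_uterm S (App f ts) \<longleftrightarrow> S f = Some (length ts) \<and> (\<forall>t\<in>set ts. wf_uterm S t)"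

fun eval_uterm :: "('f, 'u) algebra \<Rightarrow> (nat \<Rightarrow> 'u) \<Rightarrow> 'f uterm \<Rightarrow> 'u" where
  "eval_uterm A v (Var i) = v i"
| "eval_uterm A v (App f ts) = opn A f (map (eval_uterm A v) ts)"

definition satisfies :: "('f, 'u) algebra \<Rightarrow> 'f uterm \<times> 'f uterm \<Rightarrow> bool" where
  "satisfies A eq \<longleftrightarrow>
     (\<forall>v. range v \<subseteq> carrier A \<longrightarrow> eval_uterm A v (fst eq) = eval_uterm A v (snd eq))"

text \<open>
  A variety is an equational class.  HOL has no quantification over types, so a class is
  represented by its members with carrier inside \<open>'u\<close>.  For finitary signatures with countably many
  symbols and infinite \<open>'u\<close> this does not affect what an epimorphism is: if \<open>g\<close> and \<open>h\<close> from \<open>B\<close>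
  to \<open>C\<close> witness that \<open>f\<close> is not one, \<open>C\<close> can be replaced by its subalgebra generated by the images
  of \<open>g\<close> and \<open>h\<close>, which has an isomorphic copy inside \<open>'u\<close>.
\<close>

definition variety :: "'f signature \<Rightarrow> ('f, 'u) algebra set \<Rightarrow> bool" where
  "variety S K \<longleftrightarrow> (\<exists>E. (\<forall>(s, t)\<in>E. wf_uterm S s \<and> wf_uterm S t) \<and>
     K = {A. is_algebra S A \<and> (\<forall>eq\<in>E. satisfies A eq)})"

definition epimorphism ::
    "'f signature \<Rightarrow> ('f, 'u) algebra set \<Rightarrow> ('f, 'u) algebra \<Rightarrow> ('f, 'u) algebra \<Rightarrow> ('u \<Rightarrow> 'u) \<Rightarrow> bool"
  where
  "epimorphism S K A B f \<longleftrightarrow> A \<in> K \<and> B \<in> K \<and> f \<in> hom S A B \<and>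
     (\<forall>C\<in>K. \<forall>g\<in>hom S B C. \<forall>h\<in>hom S B C.
        (\<forall>x\<in>carrier A. g (f x) = h (f x)) \<longrightarrow> (\<forall>y\<in>carrier B. g y = h y))"

definition ES_property :: "'f signature \<Rightarrow> ('f, 'u) algebra set \<Rightarrow> bool" where
  "ES_property S K \<longleftrightarrow> (\<forall>A B f. epimorphism S K A B f \<longrightarrow> f ` carrier A = carrier B)"


datatype rl_op = Meet | Join | Mult | Imp | Unit | Neg

definition srl_sig :: "rl_op signature" where
  "srl_sig = [Meet \<mapsto> 2, Join \<mapsto> 2, Mult \<mapsto> 2, Imp \<mapsto> 2, Unit \<mapsto> 0]"

definition sirl_sig :: "rl_op signature" where
  "sirl_sig = srl_sig(Neg \<mapsto> 1)"

abbreviation meet :: "(rl_op, 'u) algebra \<Rightarrow> 'u \<Rightarrow> 'u \<Rightarrow> 'u" where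
  "meet A x y \<equiv> opn A Meet [x, y]"

abbreviation join :: "(rl_op, 'u) algebra \<Rightarrow> 'u \<Rightarrow> 'u \<Rightarrow> 'u" where
  "join A x y \<equiv> opn A Join [x, y]"

abbreviation mult :: "(rl_op, 'u) algebra \<Rightarrow> 'u \<Rightarrow> 'u \<Rightarrow> 'u" where
  "mult A x y \<equiv> opn A Mult [x, y]"

abbreviation imp :: "(rl_op, 'u) algebra \<Rightarrow> 'u \<Rightarrow> 'u \<Rightarrow> 'u" where
  "imp A x y \<equiv> opn A Imp [x, y]"

abbreviation unit :: "(rl_op, 'u) algebra \<Rightarrow> 'u" where
  "unit A \<equiv> opn A Unit []"

abbreviation neg :: "(rl_op, 'u) algebra \<Rightarrow> 'u \<Rightarrow> 'u" where
  "neg A x \<equiv> opn A Neg [x]"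

definition le :: "(rl_op, 'u) algebra \<Rightarrow> 'u \<Rightarrow> 'u \<Rightarrow> bool" where
  "le A x y \<longleftrightarrow> meet A x y = x"

definition lattice_ops :: "(rl_op, 'u) algebra \<Rightarrow> bool" where
  "lattice_ops A \<longleftrightarrow> (\<forall>x\<in>carrier A. \<forall>y\<in>carrier A. \<forall>z\<in>carrier A.
     meet A x y = meet A y x \<and> join A x y = join A y x \<and>
     meet A (meet A x y) z = meet A x (meet A y z) \<and>
     join A (join A x y) z = join A x (join A y z) \<and>
     meet A x (join A x y) = x \<and> join A x (meet A x y) = x)"

definition comm_monoid_ops :: "(rl_op, 'u) algebra \<Rightarrow> bool" where
  "comm_monoid_ops A \<longleftrightarrow> (\<forall>x\<in>carrier A. \<forall>y\<in>carrier A. \<forall>z\<in>carrier A.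
     mult A x y = mult A y x \<and>
     mult A (mult A x y) z = mult A x (mult A y z) \<and>
     mult A x (unit A) = x)"

definition SRL :: "(rl_op, 'u) algebra \<Rightarrow> bool" where
  "SRL A \<longleftrightarrow> is_algebra srl_sig A \<and> lattice_ops A \<and> comm_monoid_ops A \<and>
     (\<forall>x\<in>carrier A. \<forall>y\<in>carrier A. \<forall>z\<in>carrier A.
        le A (mult A x y) z \<longleftrightarrow> le A x (imp A y z)) \<and>
     (\<forall>x\<in>carrier A. le A x (unit A) \<longrightarrow> mult A x x = x)"

definition SIRL :: "(rl_op, 'u) algebra \<Rightarrow> bool" where
  "SIRL A \<longleftrightarrow> is_algebra sirl_sig A \<and> SRL A \<and>
     (\<forall>x\<in>carrier A. neg A (neg A x) = x) \<and>
     (\<forall>x\<in>carrier A. \<forall>y\<in>carrier A. imp A x (neg A y) = imp A y (neg A x))"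

text \<open>
  The negative cone is a Brouwerian algebra, in which multiplication coincides with meet; the
  interpretation of \<open>Neg\<close> in it is junk.
\<close>

definition neg_cone :: "(rl_op, 'u) algebra \<Rightarrow> (rl_op, 'u) algebra" where
  "neg_cone A = \<lparr>carrier = {a \<in> carrier A. le A a (unit A)},
     opn = (\<lambda>f xs. if f = Imp then meet A (opn A Imp xs) (unit A) else opn A f xs)\<rparr>"

definition negatively_generated :: "rl_op signature \<Rightarrow> (rl_op, 'u) algebra \<Rightarrow> bool" where
  "negatively_generated S A \<longleftrightarrow> generated S A (carrier (neg_cone A)) = carrier A"

definition prime_filters :: "(rl_op, 'u) algebra \<Rightarrow> 'u set set" where
  "prime_filters D = {F. F \<noteq> {} \<and> F \<subseteq> carrier D \<and>
     (\<forall>x\<in>F. \<forall>y\<in>carrier D. le D x y \<longrightarrow> y \<in> F) \<and>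
     (\<forall>x\<in>F. \<forall>y\<in>F. meet D x y \<in> F) \<and>
     (\<forall>x\<in>carrier D - F. \<forall>y\<in>carrier D - F. join D x y \<in> carrier D - F)}"

definition has_chain :: "(rl_op, 'u) algebra \<Rightarrow> 'u set \<Rightarrow> nat \<Rightarrow> bool" where
  "has_chain D F n \<longleftrightarrow> (\<exists>G :: nat \<Rightarrow> 'u set. G 0 = F \<and> G n = carrier D \<and>
     (\<forall>i\<le>n. G i \<in> prime_filters D) \<and> (\<forall>i<n. G i \<subset> G (Suc i)))"

text \<open>
  In \<^typ>\<open>enat\<close> the supremum of a nonempty set of numbers is its largest element, or \<open>\<infinity>\<close> if there
  is none.
\<close>

definition filter_depth :: "(rl_op, 'u) algebra \<Rightarrow> 'u set \<Rightarrow> enat" where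
  "filter_depth D F = (SUP n\<in>{n. has_chain D F n}. enat n)"

definition brouwerian_depth :: "(rl_op, 'u) algebra \<Rightarrow> enat" where
  "brouwerian_depth D = (SUP F\<in>prime_filters D. filter_depth D F)"

definition depth :: "(rl_op, 'u) algebra \<Rightarrow> enat" where
  "depth A = brouwerian_depth (neg_cone A)"

end

theory Submission
  imports Defs
begin

text \<open>
  Let \<open>U\<close> be an epic subalgebra of \<open>B \<in> K\<close>. If \<open>U\<close> maps onto \<open>B/F\<close> for a filter \<open>F\<close> of the negative
  cone, then \<open>F \<inter> U \<subseteq> G\<close> forces \<open>F \<subseteq> G\<close>: the map \<open>B \<rightarrow> B/F \<cong> U/(F \<inter> U) \<rightarrow> B/G\<close> agrees with the quotient
  map on \<open>U\<close>, hence everywhere. If this order reflection holds for all prime filters, then \<open>U\<close>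
  contains the negative cone, by the prime filter theorem.

  When \<open>{e}\<close> is prime in \<open>B\<close>, the quotients by the other prime filters have smaller depth, so by induction
  on the depth \<open>U\<close> maps onto them and thus contains the cone, which generates \<open>B\<close>. For general \<open>B\<close>,
  every quotient by a prime filter is of that kind, so again \<open>U\<close> contains the cone. Every \<open>b\<close> agrees
  modulo each prime filter with an element of \<open>U\<close>, and these local agreements are glued along
  finitely many cone elements with join \<open>e\<close>.
\<close>

section \<open>Homomorphic images and quotients\<close>

definition epic :: "'f signature \<Rightarrow> ('f, 'u) algebra set \<Rightarrow> ('f, 'u) algebra \<Rightarrow> 'u set \<Rightarrow> bool" where
  "epic S K B U \<longleftrightarrow> subuniverse S B U \<and> (\<forall>C\<in>K. \<forall>g\<in>hom S B C. \<forall>h\<in>hom S B C.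
     (\<forall>x\<in>U. g x = h x) \<longrightarrow> (\<forall>y\<in>carrier B. g y = h y))"

lemma hom_carrier: "h \<in> hom S A B \<Longrightarrow> x \<in> carrier A \<Longrightarrow> h x \<in> carrier B"
  by (auto simp: hom_def)

lemma hom_opn:
  "h \<in> hom S A B \<Longrightarrow> S f = Some (length xs) \<Longrightarrow> set xs \<subseteq> carrier A \<Longrightarrow>
    h (opn A f xs) = opn B f (map h xs)"
  by (simp add: hom_def)

lemma hom_comp:
  assumes "g \<in> hom S A B" "h \<in> hom S B C"
  shows "h \<circ> g \<in> hom S A C"
proof -
  have "h (g (opn A f xs)) = opn C f (map (h \<circ> g) xs)"
    if "S f = Some (length xs)" "set xs \<subseteq> carrier A" for f xs
  proof -
    have "set (map g xs) \<subseteq> carrier B"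
      using hom_carrier[OF assms(1)] that(2) by auto
    then show ?thesis
      using hom_opn[OF assms(1) that] hom_opn[OF assms(2), of f "map g xs"] that(1) by simp
  qed
  moreover have "(h \<circ> g) ` carrier A \<subseteq> carrier C"
    using hom_carrier[OF assms(1)] hom_carrier[OF assms(2)] by auto
  ultimately show ?thesis
    by (simp add: hom_def)
qed

lemma subuniverse_image:
  assumes "h \<in> hom S A B" "subuniverse S A U"
  shows "subuniverse S B (h ` U)"
proof -
  have "opn B f ys \<in> h ` U" if f: "S f = Some (length ys)" and ys: "set ys \<subseteq> h ` U" for f ys
  proof -
    have "ys \<in> lists (h ` U)"
      using ys by (simp add: in_lists_conv_set subset_iff)
    then obtain xs where xs: "set xs \<subseteq> U" "ys = map h xs"
      by (auto simp: lists_image)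
    have "set xs \<subseteq> carrier A" "S f = Some (length xs)"
      using xs assms(2) f by (auto simp: subuniverse_def)
    then have "opn B f ys = h (opn A f xs)" "opn A f xs \<in> U"
      using hom_opn[OF assms(1)] xs assms(2) by (simp_all add: subuniverse_def)
    then show ?thesis by simp
  qed
  moreover have "h ` U \<subseteq> carrier B"
    using assms hom_carrier[OF assms(1)] by (auto simp: subuniverse_def)
  ultimately show ?thesis
    by (simp add: subuniverse_def)
qed

lemma epic_image:
  assumes "epic S K B U" "q \<in> hom S B C" "q ` carrier B = carrier C"
  shows "epic S K C (q ` U)"
proof -
  have "g y = h y"
    if "D \<in> K" "g \<in> hom S C D" "h \<in> hom S C D" "\<forall>x\<in>q ` U. g x = h x" "y \<in> carrier C" for D g h y
  proof -
    have "g \<circ> q \<in> hom S B D" "h \<circ> q \<in> hom S B D"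
      using assms(2) that by (auto intro: hom_comp)
    moreover have "\<forall>x\<in>U. (g \<circ> q) x = (h \<circ> q) x"
      using that by simp
    ultimately have "\<forall>x\<in>carrier B. (g \<circ> q) x = (h \<circ> q) x"
      using assms(1) \<open>D \<in> K\<close> unfolding epic_def by blast
    then show ?thesis
      using that(5) assms(3) by force
  qed
  moreover have "subuniverse S C (q ` U)"
    using subuniverse_image[OF assms(2)] assms(1) by (simp add: epic_def)
  ultimately show ?thesis
    by (simp add: epic_def)
qed

lemma eval_uterm_closed:
  assumes "is_algebra S A" "range v \<subseteq> carrier A" "wf_uterm S t"
  shows "eval_uterm A v t \<in> carrier A"
  using assms(3)
proof (induction t)
  case (Var i)
  then show ?case using assms(2) by auto
next
  case (App f ts)
  then have "set (map (eval_uterm A v) ts) \<subseteq> carrier A" by auto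
  then show ?case
    using App.prems assms(1) unfolding is_algebra_def subuniverse_def by simp
qed

lemma eval_uterm_hom:
  assumes "is_algebra S A" "h \<in> hom S A B" "range v \<subseteq> carrier A" "wf_uterm S t"
  shows "eval_uterm B (\<lambda>i. h (v i)) t = h (eval_uterm A v t)"
  using assms(4)
proof (induction t)
  case (Var i)
  then show ?case by simp
next
  case (App f ts)
  have "set (map (eval_uterm A v) ts) \<subseteq> carrier A"
    using App.prems eval_uterm_closed[OF assms(1,3)] by auto
  then have "h (eval_uterm A v (App f ts)) = opn B f (map h (map (eval_uterm A v) ts))"
    using App.prems hom_opn[OF assms(2)] by simp
  moreover have "map (eval_uterm B (\<lambda>i. h (v i))) ts = map h (map (eval_uterm A v) ts)"
    using App by simp
  ultimately show ?case by (simp only: eval_uterm.simps)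
qed

lemma variety_hom_image:
  assumes "variety S K" "A \<in> K" "is_algebra S B" "h \<in> hom S A B" "h ` carrier A = carrier B"
  shows "B \<in> K"
proof -
  obtain E where E: "\<forall>(s, t)\<in>E. wf_uterm S s \<and> wf_uterm S t"
    and K: "K = {A. is_algebra S A \<and> (\<forall>eq\<in>E. satisfies A eq)}"
    using assms(1) unfolding variety_def by blast
  have alg: "is_algebra S A"
    using assms(2) K by simp
  have "satisfies B eq" if "eq \<in> E" for eq
    unfolding satisfies_def
  proof (intro allI impI)
    fix w :: "nat \<Rightarrow> 'b"
    assume "range w \<subseteq> carrier B"
    then have "\<forall>i. \<exists>x. x \<in> carrier A \<and> h x = w i"
      using assms(5) by (metis image_iff range_subsetD)
    then obtain v where v: "\<And>i. v i \<in> carrier A" "\<And>i. h (v i) = w i" by metis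
    then have "w = (\<lambda>i. h (v i))" "range v \<subseteq> carrier A" by auto
    moreover have "satisfies A eq"
      using assms(2) K that by blast
    moreover have "wf_uterm S (fst eq)" "wf_uterm S (snd eq)"
      using E that by auto
    ultimately show "eval_uterm B w (fst eq) = eval_uterm B w (snd eq)"
      using eval_uterm_hom[OF alg assms(4)] unfolding satisfies_def by simp
  qed
  then show ?thesis
    using K assms(3) by simp
qed

text \<open>The carrier of the quotient is a set of class representatives, so that it stays inside the
  carrier type.\<close>

definition rep :: "('u \<times> 'u) set \<Rightarrow> 'u \<Rightarrow> 'u" where
  "rep \<theta> x = (SOME y. (x, y) \<in> \<theta>)"

definition quot :: "('f, 'u) algebra \<Rightarrow> ('u \<times> 'u) set \<Rightarrow> ('f, 'u) algebra" where
  "quot B \<theta> = \<lparr>carrier = rep \<theta> ` carrier B, opn = (\<lambda>f xs. rep \<theta> (opn B f xs))\<rparr>"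

lemma carrier_quot: "carrier (quot B \<theta>) = rep \<theta> ` carrier B"
  and opn_quot: "opn (quot B \<theta>) f xs = rep \<theta> (opn B f xs)"
  by (simp_all add: quot_def)

context
  fixes S :: "'f signature" and B :: "('f, 'u) algebra" and \<theta> :: "('u \<times> 'u) set"
  assumes cong: "congruence S B \<theta>"
begin

lemma congruence_equiv: "equiv (carrier B) \<theta>"
  using cong by (simp add: congruence_def)

lemma rep_related: "x \<in> carrier B \<Longrightarrow> (x, rep \<theta> x) \<in> \<theta>"
  unfolding rep_def using congruence_equiv by (metis equiv_def refl_onD someI)

lemma rep_eq_iff:
  assumes "x \<in> carrier B" "y \<in> carrier B"
  shows "rep \<theta> x = rep \<theta> y \<longleftrightarrow> (x, y) \<in> \<theta>"
proof
  assume "rep \<theta> x = rep \<theta> y"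
  then show "(x, y) \<in> \<theta>"
    using rep_related[OF assms(1)] rep_related[OF assms(2)] congruence_equiv
    by (metis equiv_def symD transD)
next
  assume "(x, y) \<in> \<theta>"
  then have "(x, z) \<in> \<theta> \<longleftrightarrow> (y, z) \<in> \<theta>" for z
    using congruence_equiv by (metis equiv_def symD transD)
  then show "rep \<theta> x = rep \<theta> y"
    by (simp add: rep_def)
qed

lemma congruence_opn:
  assumes "S f = Some (length xs)" "list_all2 (\<lambda>x y. (x, y) \<in> \<theta>) xs ys"
  shows "(opn B f xs, opn B f ys) \<in> \<theta>"
  using assms cong unfolding congruence_def by blast

lemma congruence_carrier: "(x, y) \<in> \<theta> \<Longrightarrow> x \<in> carrier B \<and> y \<in> carrier B"
  using congruence_equiv by (metis equiv_class_eq_iff)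

lemma rep_hom: "rep \<theta> \<in> hom S B (quot B \<theta>)"
proof -
  have "rep \<theta> (opn B f xs) = rep \<theta> (opn B f (map (rep \<theta>) xs))"
    if f: "S f = Some (length xs)" and xs: "set xs \<subseteq> carrier B" for f xs
  proof -
    have "list_all2 (\<lambda>x y. (x, y) \<in> \<theta>) xs (map (rep \<theta>) xs)"
      using xs rep_related by (auto simp: list_all2_conv_all_nth subset_iff)
    then have "(opn B f xs, opn B f (map (rep \<theta>) xs)) \<in> \<theta>"
      by (rule congruence_opn[OF f])
    then show ?thesis
      using rep_eq_iff congruence_carrier by blast
  qed
  then show ?thesis
    by (auto simp: hom_def carrier_quot opn_quot)
qed

lemma quot_is_algebra:
  assumes "is_algebra S B"
  shows "is_algebra S (quot B \<theta>)"
  using assms subuniverse_image[OF rep_hom] by (simp add: is_algebra_def carrier_quot)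

end

text \<open>If \<open>U\<close> meets every class of \<open>\<theta>\<close>, then \<open>B/\<theta>\<close> is the quotient of \<open>U\<close> by the restriction
  of \<open>\<theta>\<close>, so it maps to \<open>B/\<phi>\<close> as soon as \<open>\<theta> \<subseteq> \<phi>\<close> holds on \<open>U\<close>. The composite \<open>B \<rightarrow> B/\<theta> \<rightarrow> B/\<phi>\<close>
  agrees with the quotient map of \<open>\<phi>\<close> on \<open>U\<close>.\<close>

lemma epic_congruence_subset:
  assumes \<theta>: "congruence S B \<theta>" and \<phi>: "congruence S B \<phi>"
    and epic: "epic S K B U" and quot: "quot B \<phi> \<in> K"
    and onto: "rep \<theta> ` U = rep \<theta> ` carrier B"
    and sub: "\<theta> \<inter> U \<times> U \<subseteq> \<phi>"
  shows "\<theta> \<subseteq> \<phi>"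
proof -
  have U: "subuniverse S B U"
    using epic by (simp add: epic_def)
  then have UB: "U \<subseteq> carrier B"
    by (simp add: subuniverse_def)
  have "\<forall>x\<in>carrier B. \<exists>a\<in>U. (a, x) \<in> \<theta>"
    using onto UB rep_eq_iff[OF \<theta>] by (metis (no_types, lifting) image_iff subsetD)
  then obtain s where s: "\<And>x. x \<in> carrier B \<Longrightarrow> s x \<in> U" "\<And>x. x \<in> carrier B \<Longrightarrow> (s x, x) \<in> \<theta>"
    by metis
  have sym: "sym \<theta>" and trans: "trans \<theta>"
    using congruence_equiv[OF \<theta>] by (auto simp: equiv_def)
  define k where "k = rep \<phi> \<circ> s"
  have k: "k x = rep \<phi> a" if "a \<in> U" "(a, x) \<in> \<theta>" for a x
  proof -
    have x: "x \<in> carrier B"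
      using that congruence_carrier[OF \<theta>] by blast
    then have "(s x, a) \<in> \<theta>"
      using s(2) that sym trans by (meson symD transD)
    then have "(s x, a) \<in> \<phi>"
      using sub s(1) x that by blast
    then show ?thesis
      using rep_eq_iff[OF \<phi>] congruence_carrier[OF \<phi>] by (auto simp: k_def)
  qed
  have "k (opn B f xs) = rep \<phi> (opn B f (map k xs))"
    if f: "S f = Some (length xs)" and xs: "set xs \<subseteq> carrier B" for f xs
  proof -
    let ?as = "map s xs"
    have as: "set ?as \<subseteq> U"
      using s(1) xs by auto
    have "list_all2 (\<lambda>x y. (x, y) \<in> \<theta>) ?as xs"
      using s(2) xs by (auto simp: list_all2_conv_all_nth subset_iff)
    then have "(opn B f ?as, opn B f xs) \<in> \<theta>"
      using f congruence_opn[OF \<theta>] by simp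
    moreover have "opn B f ?as \<in> U"
      using U f as unfolding subuniverse_def by simp
    ultimately have "k (opn B f xs) = rep \<phi> (opn B f ?as)"
      using k by blast
    also have "\<dots> = rep \<phi> (opn B f (map (rep \<phi>) ?as))"
    proof -
      have "set ?as \<subseteq> carrier B" "S f = Some (length ?as)"
        using as UB f by auto
      then show ?thesis
        using hom_opn[OF rep_hom[OF \<phi>]] by (metis opn_quot)
    qed
    finally show ?thesis by (simp add: k_def)
  qed
  moreover have "k ` carrier B \<subseteq> rep \<phi> ` carrier B"
    using s(1) UB by (auto simp: k_def)
  ultimately have "k \<in> hom S B (quot B \<phi>)"
    by (simp add: hom_def carrier_quot opn_quot)
  moreover have "\<forall>x\<in>U. k x = rep \<phi> x"
    using k UB congruence_equiv[OF \<theta>] by (meson equiv_def refl_onD subsetD)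
  ultimately have eq: "k x = rep \<phi> x" if "x \<in> carrier B" for x
    using epic quot rep_hom[OF \<phi>] that by (simp add: epic_def)
  show ?thesis
  proof
    fix p
    assume "p \<in> \<theta>"
    then obtain x y where p: "p = (x, y)" and xy: "(x, y) \<in> \<theta>"
      by (cases p) auto
    then have C: "x \<in> carrier B" "y \<in> carrier B"
      using congruence_carrier[OF \<theta>] by blast+
    have "(s x, y) \<in> \<theta>"
      using s(2)[OF C(1)] xy trans by (meson transD)
    then have "k y = k x"
      using k s C by metis
    then show "p \<in> \<phi>"
      using eq C rep_eq_iff[OF \<phi>] p by metis
  qed
qed

section \<open>Negative cones\<close>

locale srl =
  fixes A :: "(rl_op, 'u) algebra"
  assumes SRL: "SRL A"
begin

abbreviation M where "M \<equiv> carrier A"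
abbreviation e where "e \<equiv> unit A"
abbreviation inf (infixl "\<sqinter>" 70) where "x \<sqinter> y \<equiv> meet A x y"
abbreviation sup (infixl "\<squnion>" 65) where "x \<squnion> y \<equiv> join A x y"
abbreviation prod (infixl "\<odot>" 75) where "x \<odot> y \<equiv> mult A x y"
abbreviation res (infixr "\<leadsto>" 60) where "x \<leadsto> y \<equiv> imp A x y"
abbreviation leq (infix "\<sqsubseteq>" 50) where "x \<sqsubseteq> y \<equiv> le A x y"

lemma is_algebra: "is_algebra srl_sig A"
  using SRL by (simp add: SRL_def)

lemma opn_closed:
  "srl_sig f = Some (length xs) \<Longrightarrow> set xs \<subseteq> M \<Longrightarrow> opn A f xs \<in> M"
  using is_algebra by (simp add: is_algebra_def subuniverse_def)

lemma unit_closed [simp]: "e \<in> M"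
  using opn_closed[of Unit "[]"] by (simp add: srl_sig_def)

lemma closed [simp]:
  assumes "x \<in> M" "y \<in> M"
  shows "x \<sqinter> y \<in> M" "x \<squnion> y \<in> M" "x \<odot> y \<in> M" "x \<leadsto> y \<in> M"
  using assms opn_closed[of _ "[x, y]"] by (simp_all add: srl_sig_def)

lemma inf_commute: "x \<in> M \<Longrightarrow> y \<in> M \<Longrightarrow> x \<sqinter> y = y \<sqinter> x"
  and sup_commute: "x \<in> M \<Longrightarrow> y \<in> M \<Longrightarrow> x \<squnion> y = y \<squnion> x"
  and inf_assoc: "x \<in> M \<Longrightarrow> y \<in> M \<Longrightarrow> z \<in> M \<Longrightarrow> (x \<sqinter> y) \<sqinter> z = x \<sqinter> (y \<sqinter> z)"
  and sup_assoc: "x \<in> M \<Longrightarrow> y \<in> M \<Longrightarrow> z \<in> M \<Longrightarrow> (x \<squnion> y) \<squnion> z = x \<squnion> (y \<squnion> z)"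
  and inf_absorb: "x \<in> M \<Longrightarrow> y \<in> M \<Longrightarrow> x \<sqinter> (x \<squnion> y) = x"
  and sup_absorb: "x \<in> M \<Longrightarrow> y \<in> M \<Longrightarrow> x \<squnion> (x \<sqinter> y) = x"
  using SRL unfolding SRL_def lattice_ops_def by blast+

lemma prod_commute: "x \<in> M \<Longrightarrow> y \<in> M \<Longrightarrow> x \<odot> y = y \<odot> x"
  and prod_assoc: "x \<in> M \<Longrightarrow> y \<in> M \<Longrightarrow> z \<in> M \<Longrightarrow> (x \<odot> y) \<odot> z = x \<odot> (y \<odot> z)"
  and prod_unit [simp]: "x \<in> M \<Longrightarrow> x \<odot> e = x"
  using SRL unfolding SRL_def comm_monoid_ops_def by blast+

lemma unit_prod [simp]: "x \<in> M \<Longrightarrow> e \<odot> x = x"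
  using prod_commute by simp

lemma prod_left_commute:
  assumes "x \<in> M" "y \<in> M" "z \<in> M"
  shows "x \<odot> (y \<odot> z) = y \<odot> (x \<odot> z)"
  using assms prod_assoc[of x y z] prod_assoc[of y x z] prod_commute[of x y] by simp

lemma residuation: "x \<in> M \<Longrightarrow> y \<in> M \<Longrightarrow> z \<in> M \<Longrightarrow> x \<odot> y \<sqsubseteq> z \<longleftrightarrow> x \<sqsubseteq> y \<leadsto> z"
  and idem: "x \<in> M \<Longrightarrow> x \<sqsubseteq> e \<Longrightarrow> x \<odot> x = x"
  using SRL unfolding SRL_def by blast+

lemma inf_idem: "x \<in> M \<Longrightarrow> x \<sqinter> x = x"
  by (metis closed(1) inf_absorb sup_absorb)

lemma leq_refl [simp]: "x \<in> M \<Longrightarrow> x \<sqsubseteq> x"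
  by (simp add: le_def inf_idem)

lemma leq_antisym: "x \<sqsubseteq> y \<Longrightarrow> y \<sqsubseteq> x \<Longrightarrow> x \<in> M \<Longrightarrow> y \<in> M \<Longrightarrow> x = y"
  by (metis le_def inf_commute)

lemma leq_trans: "x \<sqsubseteq> y \<Longrightarrow> y \<sqsubseteq> z \<Longrightarrow> x \<in> M \<Longrightarrow> y \<in> M \<Longrightarrow> z \<in> M \<Longrightarrow> x \<sqsubseteq> z"
  by (metis le_def inf_assoc)

lemma inf_lower1 [simp]: "x \<in> M \<Longrightarrow> y \<in> M \<Longrightarrow> x \<sqinter> y \<sqsubseteq> x"
  by (metis closed(1) inf_assoc inf_commute inf_idem le_def)

lemma inf_lower2 [simp]: "x \<in> M \<Longrightarrow> y \<in> M \<Longrightarrow> x \<sqinter> y \<sqsubseteq> y"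
  by (metis inf_commute inf_lower1)

lemma inf_greatest: "z \<sqsubseteq> x \<Longrightarrow> z \<sqsubseteq> y \<Longrightarrow> x \<in> M \<Longrightarrow> y \<in> M \<Longrightarrow> z \<in> M \<Longrightarrow> z \<sqsubseteq> x \<sqinter> y"
  by (metis inf_assoc le_def)

lemma leq_iff_sup: "x \<in> M \<Longrightarrow> y \<in> M \<Longrightarrow> x \<sqsubseteq> y \<longleftrightarrow> x \<squnion> y = y"
  by (metis inf_absorb inf_commute le_def sup_absorb sup_commute)

lemma sup_upper1 [simp]: "x \<in> M \<Longrightarrow> y \<in> M \<Longrightarrow> x \<sqsubseteq> x \<squnion> y"
  by (simp add: le_def inf_absorb)

lemma sup_upper2 [simp]: "x \<in> M \<Longrightarrow> y \<in> M \<Longrightarrow> y \<sqsubseteq> x \<squnion> y"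
  by (metis sup_commute sup_upper1)

lemma sup_least: "x \<sqsubseteq> z \<Longrightarrow> y \<sqsubseteq> z \<Longrightarrow> x \<in> M \<Longrightarrow> y \<in> M \<Longrightarrow> z \<in> M \<Longrightarrow> x \<squnion> y \<sqsubseteq> z"
  by (metis closed(2) leq_iff_sup sup_assoc)

lemma prod_mono_left:
  assumes "x \<sqsubseteq> y" "x \<in> M" "y \<in> M" "z \<in> M"
  shows "x \<odot> z \<sqsubseteq> y \<odot> z"
proof -
  have "y \<sqsubseteq> z \<leadsto> y \<odot> z"
    using assms residuation[of y z "y \<odot> z"] by simp
  then show ?thesis
    using assms residuation[of x z "y \<odot> z"] leq_trans[of x y "z \<leadsto> y \<odot> z"] by simp
qed

lemma prod_mono:
  assumes "x \<sqsubseteq> y" "z \<sqsubseteq> w" "x \<in> M" "y \<in> M" "z \<in> M" "w \<in> M"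
  shows "x \<odot> z \<sqsubseteq> y \<odot> w"
  using prod_mono_left[of x y z] prod_mono_left[of z w y] prod_commute[of y z] prod_commute[of y w]
    leq_trans[of "x \<odot> z" "y \<odot> z" "y \<odot> w"] assms by simp

lemma prod_sup_distrib:
  assumes "x \<in> M" "y \<in> M" "z \<in> M"
  shows "z \<odot> (x \<squnion> y) = (z \<odot> x) \<squnion> (z \<odot> y)"
proof (rule leq_antisym)
  let ?r = "(z \<odot> x) \<squnion> (z \<odot> y)"
  have "x \<sqsubseteq> z \<leadsto> ?r" "y \<sqsubseteq> z \<leadsto> ?r"
    using assms residuation[of x z ?r] residuation[of y z ?r] prod_commute[of z] by simp_all
  then have "x \<squnion> y \<sqsubseteq> z \<leadsto> ?r"
    using assms by (simp add: sup_least)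
  then show "z \<odot> (x \<squnion> y) \<sqsubseteq> ?r"
    using assms residuation[of "x \<squnion> y" z ?r] prod_commute[of z "x \<squnion> y"] by simp
  show "?r \<sqsubseteq> z \<odot> (x \<squnion> y)"
    using assms by (intro sup_least prod_mono) simp_all
qed (use assms in simp_all)

abbreviation N where "N \<equiv> carrier (neg_cone A)"

lemma N_iff: "x \<in> N \<longleftrightarrow> x \<in> M \<and> x \<sqsubseteq> e"
  by (simp add: neg_cone_def)

lemma N_M: "x \<in> N \<Longrightarrow> x \<in> M" and N_leq: "x \<in> N \<Longrightarrow> x \<sqsubseteq> e"
  by (simp_all add: N_iff)

lemma unit_N [simp]: "e \<in> N"
  by (simp add: N_iff)

lemma neg_cone_opn [simp]:
  "le (neg_cone A) x y \<longleftrightarrow> x \<sqsubseteq> y"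
  "meet (neg_cone A) x y = x \<sqinter> y"
  "join (neg_cone A) x y = x \<squnion> y"
  by (simp_all add: neg_cone_def le_def)

lemma N_down: "x \<sqsubseteq> y \<Longrightarrow> x \<in> M \<Longrightarrow> y \<in> N \<Longrightarrow> x \<in> N"
  using leq_trans[of x y e] by (auto simp: N_iff)

lemma prod_lower2:
  assumes "x \<in> N" "y \<in> M"
  shows "x \<odot> y \<sqsubseteq> y"
  using assms prod_mono[of x e y y] by (simp add: N_iff)

lemma prod_lower1:
  assumes "x \<in> M" "y \<in> N"
  shows "x \<odot> y \<sqsubseteq> x"
  using assms prod_lower2[of y x] prod_commute[of x y] by (simp add: N_iff)

lemma prod_eq_inf:
  assumes "x \<in> N" "y \<in> N"
  shows "x \<odot> y = x \<sqinter> y"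
proof (rule leq_antisym)
  have "x \<in> M" "y \<in> M" "x \<sqinter> y \<in> N"
    using assms N_down[of "x \<sqinter> y" x] by (simp_all add: N_iff)
  then show "x \<odot> y \<sqsubseteq> x \<sqinter> y" "x \<sqinter> y \<sqsubseteq> x \<odot> y" "x \<odot> y \<in> M" "x \<sqinter> y \<in> M"
    using assms prod_lower1[of x y] prod_lower2[of x y] prod_mono[of "x \<sqinter> y" x "x \<sqinter> y" y]
      idem[of "x \<sqinter> y"] by (simp_all add: inf_greatest N_iff)
qed

lemma inf_N [simp]: "x \<in> N \<Longrightarrow> y \<in> N \<Longrightarrow> x \<sqinter> y \<in> N"
  using N_down[of "x \<sqinter> y" x] by (simp add: N_iff)

lemma inf_unit_N [simp]: "x \<in> M \<Longrightarrow> x \<sqinter> e \<in> N"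
  by (simp add: N_iff)

lemma prod_N [simp]: "x \<in> N \<Longrightarrow> y \<in> N \<Longrightarrow> x \<odot> y \<in> N"
  by (simp add: prod_eq_inf)

lemma sup_N [simp]: "x \<in> N \<Longrightarrow> y \<in> N \<Longrightarrow> x \<squnion> y \<in> N"
  by (simp add: N_iff sup_least)

lemma prod_absorb:
  assumes "x \<in> N" "y \<in> N" "x \<sqsubseteq> y"
  shows "x \<odot> y = x"
  using assms prod_eq_inf by (simp add: le_def)

definition cone_filter :: "'u set \<Rightarrow> bool" where
  "cone_filter F \<longleftrightarrow> e \<in> F \<and> F \<subseteq> N \<and> (\<forall>x\<in>F. \<forall>y\<in>N. x \<sqsubseteq> y \<longrightarrow> y \<in> F) \<and>
     (\<forall>x\<in>F. \<forall>y\<in>F. x \<odot> y \<in> F)"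

abbreviation P where "P \<equiv> prime_filters (neg_cone A)"

lemma prime_filter_iff:
  "F \<in> P \<longleftrightarrow> cone_filter F \<and> (\<forall>x\<in>N. \<forall>y\<in>N. x \<squnion> y \<in> F \<longrightarrow> x \<in> F \<or> y \<in> F)"
proof -
  have "e \<in> F" if "F \<noteq> {}" "F \<subseteq> N" "\<forall>x\<in>F. \<forall>y\<in>N. x \<sqsubseteq> y \<longrightarrow> y \<in> F"
    using that unit_N N_leq by blast
  then have *: "F \<noteq> {} \<and> F \<subseteq> N \<and> (\<forall>x\<in>F. \<forall>y\<in>N. x \<sqsubseteq> y \<longrightarrow> y \<in> F) \<longleftrightarrow>
      e \<in> F \<and> F \<subseteq> N \<and> (\<forall>x\<in>F. \<forall>y\<in>N. x \<sqsubseteq> y \<longrightarrow> y \<in> F)"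
    by blast
  have "x \<odot> y = x \<sqinter> y" if "F \<subseteq> N" "x \<in> F" "y \<in> F" for x y
    using that by (simp add: prod_eq_inf subsetD)
  then have **: "F \<subseteq> N \<Longrightarrow> (\<forall>x\<in>F. \<forall>y\<in>F. x \<sqinter> y \<in> F) \<longleftrightarrow> (\<forall>x\<in>F. \<forall>y\<in>F. x \<odot> y \<in> F)"
    by simp
  have "x \<squnion> y \<in> N - F \<longleftrightarrow> x \<squnion> y \<notin> F" if "x \<in> N" "y \<in> N" for x y
    using that by simp
  then have ***: "(\<forall>x\<in>N - F. \<forall>y\<in>N - F. x \<squnion> y \<in> N - F) \<longleftrightarrow>
      (\<forall>x\<in>N. \<forall>y\<in>N. x \<squnion> y \<in> F \<longrightarrow> x \<in> F \<or> y \<in> F)"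
    by (metis DiffD1 DiffD2 DiffI)
  show ?thesis
    unfolding prime_filters_def cone_filter_def mem_Collect_eq neg_cone_opn ***
    using * ** by argo
qed

lemma cone_filterD:
  assumes "cone_filter F"
  shows "e \<in> F" "F \<subseteq> N" "\<And>x y. x \<in> F \<Longrightarrow> y \<in> N \<Longrightarrow> x \<sqsubseteq> y \<Longrightarrow> y \<in> F"
    "\<And>x y. x \<in> F \<Longrightarrow> y \<in> F \<Longrightarrow> x \<odot> y \<in> F"
  using assms unfolding cone_filter_def by blast+

lemma N_mem_P: "N \<in> P"
  by (auto simp: prime_filter_iff cone_filter_def)

lemma cone_filter_unit: "cone_filter {e}"
proof -
  have "y = e" if "y \<in> N" "e \<sqsubseteq> y" for y
    using that by (simp add: N_iff leq_antisym)
  then show ?thesis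
    by (auto simp: cone_filter_def)
qed

theorem prime_filter_exists:
  assumes F: "cone_filter F" and IN: "I \<subseteq> N"
    and down: "\<And>x y. x \<in> N \<Longrightarrow> y \<in> I \<Longrightarrow> x \<sqsubseteq> y \<Longrightarrow> x \<in> I"
    and sup: "\<And>x y. x \<in> I \<Longrightarrow> y \<in> I \<Longrightarrow> x \<squnion> y \<in> I"
    and disj: "F \<inter> I = {}"
  obtains G where "G \<in> P" "F \<subseteq> G" "G \<inter> I = {}"
proof -
  define X where "X = {G. cone_filter G \<and> F \<subseteq> G \<and> G \<inter> I = {}}"
  have "\<Union>\<C> \<in> X" if ne: "\<C> \<noteq> {}" and chain: "subset.chain X \<C>" for \<C>
  proof -
    have CX: "\<C> \<subseteq> X"
      using chain by (simp add: subset.chain_def)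
    have "x \<odot> y \<in> \<Union>\<C>" if xy: "x \<in> \<Union>\<C>" "y \<in> \<Union>\<C>" for x y
    proof -
      obtain G H where GH: "G \<in> \<C>" "x \<in> G" "H \<in> \<C>" "y \<in> H"
        using xy by blast
      then have "G \<subseteq> H \<or> H \<subseteq> G"
        using chain by (auto simp: subset_chain_def)
      then obtain L where L: "L \<in> \<C>" "x \<in> L" "y \<in> L"
        using GH by blast
      then have "cone_filter L"
        using CX by (auto simp: X_def)
      then show ?thesis
        using L cone_filterD(4) by blast
    qed
    moreover have "e \<in> \<Union>\<C>"
      using ne CX cone_filterD(1) by (fastforce simp: X_def)
    moreover have "\<Union>\<C> \<subseteq> N"
      using CX cone_filterD(2) by (fastforce simp: X_def)
    moreover have "y \<in> \<Union>\<C>" if xy: "x \<in> \<Union>\<C>" "y \<in> N" "x \<sqsubseteq> y" for x y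
    proof -
      obtain G where G: "G \<in> \<C>" "x \<in> G"
        using xy by blast
      then have "cone_filter G"
        using CX by (auto simp: X_def)
      then show ?thesis
        using xy G cone_filterD(3) by blast
    qed
    ultimately have "cone_filter (\<Union>\<C>)"
      by (simp add: cone_filter_def)
    moreover have "F \<subseteq> \<Union>\<C>" "\<Union>\<C> \<inter> I = {}"
      using ne CX by (auto simp: X_def)
    ultimately show ?thesis
      by (simp add: X_def)
  qed
  moreover have "X \<noteq> {}"
    using F disj by (auto simp: X_def)
  ultimately obtain G where G: "G \<in> X" and max: "\<forall>H\<in>X. G \<subseteq> H \<longrightarrow> H = G"
    using subset_Zorn_nonempty[of X] by blast
  have cf: "cone_filter G"
    using G by (simp add: X_def)
  have meets: "\<exists>c\<in>G. c \<odot> x \<in> I" if x: "x \<in> N" "x \<notin> G" for x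
  proof (rule ccontr)
    assume no: "\<not> ?thesis"
    define H where "H = {y \<in> N. \<exists>c\<in>G. c \<odot> x \<sqsubseteq> y}"
    have "cone_filter H"
      unfolding cone_filter_def
    proof (intro conjI ballI impI)
      show "e \<in> H"
        using cone_filterD(1)[OF cf] x N_leq[of x] by (auto simp: H_def N_M intro!: bexI[of _ e])
      show "H \<subseteq> N" by (auto simp: H_def)
    next
      fix y z
      assume "y \<in> H" "z \<in> N" "y \<sqsubseteq> z"
      then obtain c where "c \<in> G" "c \<odot> x \<sqsubseteq> y" "y \<in> N" by (auto simp: H_def)
      moreover have "c \<in> M"
        using \<open>c \<in> G\<close> cone_filterD(2)[OF cf] N_M by blast
      ultimately show "z \<in> H"
        using \<open>z \<in> N\<close> \<open>y \<sqsubseteq> z\<close> x leq_trans[of "c \<odot> x" y z] by (auto simp: H_def N_M)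
    next
      fix y z
      assume "y \<in> H" "z \<in> H"
      then obtain c d where cd: "c \<in> G" "c \<odot> x \<sqsubseteq> y" "y \<in> N" "d \<in> G" "d \<odot> x \<sqsubseteq> z" "z \<in> N"
        by (auto simp: H_def)
      then have N: "c \<in> N" "d \<in> N"
        using cone_filterD(2)[OF cf] by auto
      have "(c \<odot> d) \<odot> x \<sqsubseteq> c \<odot> x" "(c \<odot> d) \<odot> x \<sqsubseteq> d \<odot> x"
        using N x prod_lower1[of c d] prod_lower2[of c d] by (auto intro!: prod_mono_left simp: N_M)
      then have "(c \<odot> d) \<odot> x \<sqsubseteq> y \<sqinter> z"
        using N x cd leq_trans[of "(c \<odot> d) \<odot> x"] by (intro inf_greatest) (meson N_M closed)+
      then show "y \<odot> z \<in> H"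
        using cd cone_filterD(4)[OF cf] prod_eq_inf[of y z] by (auto simp: H_def)
    qed
    moreover have "G \<subseteq> H"
      using cone_filterD(2)[OF cf] x prod_lower1 N_M by (fastforce simp: H_def)
    moreover have "H \<inter> I = {}"
    proof -
      have False if "y \<in> I" "c \<in> G" "c \<odot> x \<sqsubseteq> y" for c y
        using that no down[of "c \<odot> x" y] cone_filterD(2)[OF cf] x by auto
      then show ?thesis
        by (auto simp: H_def)
    qed
    ultimately have "H \<in> X" "G \<subseteq> H"
      using G by (auto simp: X_def)
    then have "H = G"
      using max by blast
    moreover have "x \<in> H"
      using x cone_filterD(1)[OF cf] by (auto simp: H_def N_M intro!: bexI[of _ e])
    ultimately show False
      using x by simp
  qed
  have "x \<in> G \<or> y \<in> G" if xy: "x \<in> N" "y \<in> N" "x \<squnion> y \<in> G" for x y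
  proof (rule ccontr)
    assume "\<not> ?thesis"
    then obtain c d where cd: "c \<in> G" "c \<odot> x \<in> I" "d \<in> G" "d \<odot> y \<in> I"
      using meets xy by blast
    then have N: "c \<in> N" "d \<in> N"
      using cone_filterD(2)[OF cf] by auto
    have "(c \<odot> d) \<odot> x \<sqsubseteq> c \<odot> x" "(c \<odot> d) \<odot> y \<sqsubseteq> d \<odot> y"
      using N xy prod_lower1[of c d] prod_lower2[of c d] by (auto intro!: prod_mono_left simp: N_M)
    then have "(c \<odot> d) \<odot> x \<in> I" "(c \<odot> d) \<odot> y \<in> I"
      using down N xy cd by (meson prod_N)+
    then have "(c \<odot> d) \<odot> (x \<squnion> y) \<in> I"
      using sup prod_sup_distrib N xy by (simp add: N_M)
    moreover have "(c \<odot> d) \<odot> (x \<squnion> y) \<in> G"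
      using cd xy cone_filterD(4)[OF cf] by blast
    ultimately show False
      using G by (auto simp: X_def)
  qed
  then have "G \<in> P"
    using cf by (simp add: prime_filter_iff)
  then show thesis
    using that G by (simp add: X_def)
qed

end


section \<open>Filters and congruences\<close>

locale rl = srl A for A :: "(rl_op, 'u) algebra" +
  fixes S :: "rl_op signature"
  assumes sig: "S = srl_sig \<or> S = sirl_sig \<and> SIRL A"
begin

lemma S_simps [simp]:
  "S Meet = Some 2" "S Join = Some 2" "S Mult = Some 2" "S Imp = Some 2" "S Unit = Some 0"
  using sig by (auto simp: srl_sig_def sirl_sig_def)

lemma S_Neg:
  assumes "S Neg = Some n"
  shows "n = 1" "SIRL A"
  using assms sig by (auto simp: srl_sig_def sirl_sig_def)

lemma is_algebra_S: "is_algebra S A"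
  using sig SRL by (auto simp: SRL_def SIRL_def)

lemma subuniverse_closed:
  assumes "subuniverse S A U"
  shows "U \<subseteq> M" "e \<in> U"
    "x \<in> U \<Longrightarrow> y \<in> U \<Longrightarrow> x \<sqinter> y \<in> U" "x \<in> U \<Longrightarrow> y \<in> U \<Longrightarrow> x \<squnion> y \<in> U"
    "x \<in> U \<Longrightarrow> y \<in> U \<Longrightarrow> x \<odot> y \<in> U" "x \<in> U \<Longrightarrow> y \<in> U \<Longrightarrow> x \<leadsto> y \<in> U"
proof -
  have opn: "opn A f xs \<in> U" if "S f = Some (length xs)" "set xs \<subseteq> U" for f xs
    using assms that by (simp add: subuniverse_def)
  show "U \<subseteq> M"
    using assms by (simp add: subuniverse_def)
  show "e \<in> U"
    by (rule opn) simp_all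
  assume "x \<in> U" "y \<in> U"
  then show "x \<sqinter> y \<in> U" "x \<squnion> y \<in> U" "x \<odot> y \<in> U" "x \<leadsto> y \<in> U"
    by (auto intro: opn)
qed

definition below :: "'u set \<Rightarrow> 'u \<Rightarrow> 'u \<Rightarrow> bool" where
  "below F x y \<longleftrightarrow> x \<in> M \<and> y \<in> M \<and> (\<exists>c\<in>F. c \<odot> x \<sqsubseteq> y)"

definition filter_cong :: "'u set \<Rightarrow> ('u \<times> 'u) set" where
  "filter_cong F = {(x, y). below F x y \<and> below F y x}"

lemma below_iff:
  assumes "cone_filter F"
  shows "below F x y \<longleftrightarrow> x \<in> M \<and> y \<in> M \<and> (x \<leadsto> y) \<sqinter> e \<in> F"
proof -
  have "(\<exists>c\<in>F. c \<odot> x \<sqsubseteq> y) \<longleftrightarrow> (x \<leadsto> y) \<sqinter> e \<in> F" if x: "x \<in> M" and y: "y \<in> M"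
  proof
    assume "\<exists>c\<in>F. c \<odot> x \<sqsubseteq> y"
    then obtain c where c: "c \<in> F" "c \<odot> x \<sqsubseteq> y" by blast
    then have "c \<in> N"
      using cone_filterD(2)[OF assms] by blast
    then have "c \<sqsubseteq> (x \<leadsto> y) \<sqinter> e"
      using c x y residuation[of c x y] by (simp add: inf_greatest N_iff)
    then show "(x \<leadsto> y) \<sqinter> e \<in> F"
      using cone_filterD(3)[OF assms] c x y by simp
  next
    assume "(x \<leadsto> y) \<sqinter> e \<in> F"
    moreover have "((x \<leadsto> y) \<sqinter> e) \<odot> x \<sqsubseteq> y"
      using x y by (simp add: residuation)
    ultimately show "\<exists>c\<in>F. c \<odot> x \<sqsubseteq> y" by blast
  qed
  then show ?thesis by (auto simp: below_def)
qed

context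
  fixes F :: "'u set"
  assumes F: "cone_filter F"
begin

lemma F_N: "c \<in> F \<Longrightarrow> c \<in> N" and F_M: "c \<in> F \<Longrightarrow> c \<in> M"
  using cone_filterD(2)[OF F] N_M by blast+

lemma F_prod: "c \<in> F \<Longrightarrow> d \<in> F \<Longrightarrow> c \<odot> d \<in> F"
  using cone_filterD(4)[OF F] by blast

lemma belowI: "c \<in> F \<Longrightarrow> c \<odot> x \<sqsubseteq> y \<Longrightarrow> x \<in> M \<Longrightarrow> y \<in> M \<Longrightarrow> below F x y"
  by (auto simp: below_def)

lemma belowE:
  assumes "below F x y"
  obtains c where "c \<in> F" "c \<in> N" "c \<in> M" "c \<odot> x \<sqsubseteq> y" "x \<in> M" "y \<in> M"
  using assms F_N F_M by (auto simp: below_def)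

lemma below_refl: "x \<in> M \<Longrightarrow> below F x x"
  using belowI[of e x x] cone_filterD(1)[OF F] by simp

lemma below_trans:
  assumes "below F x y" "below F y z"
  shows "below F x z"
proof -
  obtain c where c: "c \<in> F" "c \<in> N" "c \<in> M" "c \<odot> x \<sqsubseteq> y" "x \<in> M" "y \<in> M"
    using assms(1) by (rule belowE)
  obtain d where d: "d \<in> F" "d \<in> N" "d \<in> M" "d \<odot> y \<sqsubseteq> z" "z \<in> M"
    using assms(2) by (rule belowE)
  have "(d \<odot> c) \<odot> x \<sqsubseteq> d \<odot> y"
    using c d by (simp add: prod_assoc prod_mono)
  then show ?thesis
    using c d leq_trans[of "(d \<odot> c) \<odot> x" "d \<odot> y" z] by (intro belowI[of "d \<odot> c"]) (simp_all add: F_prod)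
qed

lemma below_common:
  assumes "below F x x'" "below F y y'"
  obtains c where "c \<in> F" "c \<in> N" "c \<in> M" "c \<odot> x \<sqsubseteq> x'" "c \<odot> y \<sqsubseteq> y'"
    "x \<in> M" "y \<in> M" "x' \<in> M" "y' \<in> M"
proof -
  obtain c where c: "c \<in> F" "c \<in> N" "c \<in> M" "c \<odot> x \<sqsubseteq> x'" "x \<in> M" "x' \<in> M"
    using assms(1) by (rule belowE)
  obtain d where d: "d \<in> F" "d \<in> N" "d \<in> M" "d \<odot> y \<sqsubseteq> y'" "y \<in> M" "y' \<in> M"
    using assms(2) by (rule belowE)
  have "(c \<odot> d) \<odot> x \<sqsubseteq> c \<odot> x" "(c \<odot> d) \<odot> y \<sqsubseteq> d \<odot> y"
    using c d prod_lower1[of c d] prod_lower2[of c d] by (auto intro!: prod_mono_left)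
  then have "(c \<odot> d) \<odot> x \<sqsubseteq> x'" "(c \<odot> d) \<odot> y \<sqsubseteq> y'"
    using c d leq_trans[of "(c \<odot> d) \<odot> x" "c \<odot> x" x'] leq_trans[of "(c \<odot> d) \<odot> y" "d \<odot> y" y']
    by simp_all
  then show thesis
    using c d F_prod by (intro that[of "c \<odot> d"]) simp_all
qed

lemma below_mono:
  assumes "below F x x'" "below F y y'"
  shows "below F (x \<sqinter> y) (x' \<sqinter> y')" "below F (x \<squnion> y) (x' \<squnion> y')" "below F (x \<odot> y) (x' \<odot> y')"
proof -
  obtain c where c: "c \<in> F" "c \<in> N" "c \<in> M" "c \<odot> x \<sqsubseteq> x'" "c \<odot> y \<sqsubseteq> y'"
    and M: "x \<in> M" "y \<in> M" "x' \<in> M" "y' \<in> M"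
    using assms by (rule below_common)
  have "c \<odot> (x \<sqinter> y) \<sqsubseteq> c \<odot> x" "c \<odot> (x \<sqinter> y) \<sqsubseteq> c \<odot> y"
    using c M by (auto intro: prod_mono)
  then have "c \<odot> (x \<sqinter> y) \<sqsubseteq> x' \<sqinter> y'"
    using c M leq_trans[of "c \<odot> (x \<sqinter> y)" "c \<odot> x" x'] leq_trans[of "c \<odot> (x \<sqinter> y)" "c \<odot> y" y']
    by (simp add: inf_greatest)
  then show "below F (x \<sqinter> y) (x' \<sqinter> y')"
    using c M by (intro belowI[of c]) simp_all
  have "c \<odot> x \<sqsubseteq> x' \<squnion> y'" "c \<odot> y \<sqsubseteq> x' \<squnion> y'"
    using c M leq_trans[of "c \<odot> x" x' "x' \<squnion> y'"] leq_trans[of "c \<odot> y" y' "x' \<squnion> y'"] by simp_all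
  then show "below F (x \<squnion> y) (x' \<squnion> y')"
    using c M by (intro belowI[of c]) (simp_all add: prod_sup_distrib sup_least)
  have "(c \<odot> c) \<odot> (x \<odot> y) = (c \<odot> x) \<odot> (c \<odot> y)"
    using c(3) M by (simp add: prod_assoc prod_commute prod_left_commute)
  then have "(c \<odot> c) \<odot> (x \<odot> y) \<sqsubseteq> x' \<odot> y'"
    using c M by (simp add: prod_mono)
  then show "below F (x \<odot> y) (x' \<odot> y')"
    using c M F_prod by (intro belowI[of "c \<odot> c"]) simp_all
qed

lemma below_imp:
  assumes "below F x' x" "below F y y'"
  shows "below F (x \<leadsto> y) (x' \<leadsto> y')"
proof -
  obtain c where c: "c \<in> F" "c \<in> N" "c \<in> M" "c \<odot> x' \<sqsubseteq> x" "c \<odot> y \<sqsubseteq> y'"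
    and M: "x' \<in> M" "y \<in> M" "x \<in> M" "y' \<in> M"
    using assms by (rule below_common)
  let ?r = "x \<leadsto> y"
  have "?r \<odot> x \<sqsubseteq> y"
    using M by (simp add: residuation)
  have "((c \<odot> c) \<odot> ?r) \<odot> x' = c \<odot> (?r \<odot> (c \<odot> x'))"
    using c(3) M by (simp add: prod_assoc prod_commute prod_left_commute)
  also have "\<dots> \<sqsubseteq> c \<odot> (?r \<odot> x)"
    using c M by (simp add: prod_mono)
  finally have 1: "((c \<odot> c) \<odot> ?r) \<odot> x' \<sqsubseteq> c \<odot> (?r \<odot> x)" .
  have 2: "c \<odot> (?r \<odot> x) \<sqsubseteq> c \<odot> y"
    using c M \<open>?r \<odot> x \<sqsubseteq> y\<close> by (simp add: prod_mono)
  have "((c \<odot> c) \<odot> ?r) \<odot> x' \<sqsubseteq> y'"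
    using leq_trans[OF 1 2] leq_trans[of _ "c \<odot> y" y'] c M by simp
  then show ?thesis
    using c M F_prod by (intro belowI[of "c \<odot> c"]) (simp_all add: residuation)
qed

lemma below_neg:
  assumes "SIRL A" "below F x y"
  shows "below F (neg A y) (neg A x)"
proof -
  obtain c where c: "c \<in> F" "c \<in> N" "c \<in> M" "c \<odot> x \<sqsubseteq> y" and M: "x \<in> M" "y \<in> M"
    using assms(2) by (rule belowE)
  have neg: "neg A z \<in> M" if "z \<in> M" for z
  proof -
    have "subuniverse sirl_sig A M"
      using assms(1) by (simp add: SIRL_def is_algebra_def)
    moreover have "sirl_sig Neg = Some (length [z])" "set [z] \<subseteq> M"
      using that by (simp_all add: sirl_sig_def)
    ultimately show ?thesis
      unfolding subuniverse_def by blast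
  qed
  have "neg A y \<leadsto> neg A x = x \<leadsto> neg A (neg A y)"
    using assms(1) M neg by (simp add: SIRL_def)
  also have "\<dots> = x \<leadsto> y"
    using assms(1) M by (simp add: SIRL_def)
  finally have "neg A y \<leadsto> neg A x = x \<leadsto> y" .
  then have "c \<sqsubseteq> neg A y \<leadsto> neg A x"
    using c M by (simp add: residuation[symmetric])
  then show ?thesis
    using c M neg by (intro belowI[of c]) (simp_all add: residuation)
qed

lemma filter_cong_congruence: "congruence S A (filter_cong F)"
  unfolding congruence_def
proof (intro conjI allI impI)
  show "equiv M (filter_cong F)"
  proof (rule equivI)
    show "filter_cong F \<subseteq> M \<times> M"
      by (auto simp: filter_cong_def below_def)
    show "refl_on M (filter_cong F)"
      by (auto simp: filter_cong_def refl_on_def below_refl)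
    show "sym (filter_cong F)"
      by (auto simp: filter_cong_def sym_def)
    show "trans (filter_cong F)"
      by (auto simp: filter_cong_def trans_def intro: below_trans)
  qed
next
  fix f xs ys
  assume *: "S f = Some (length xs) \<and> list_all2 (\<lambda>x y. (x, y) \<in> filter_cong F) xs ys"
  then have len: "S f = Some (length xs)" by blast
  have two: thesis if two: "length xs = 2"
    and thesis: "\<And>a b c d. xs = [a, b] \<Longrightarrow> ys = [c, d] \<Longrightarrow> below F a c \<Longrightarrow> below F c a \<Longrightarrow>
      below F b d \<Longrightarrow> below F d b \<Longrightarrow> thesis" for thesis
  proof -
    obtain a b where "xs = [a, b]"
      using two by (auto simp: length_Suc_conv numeral_2_eq_2)
    then show thesis
      using * thesis by (auto simp: list_all2_Cons1 filter_cong_def)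
  qed
  show "(opn A f xs, opn A f ys) \<in> filter_cong F"
  proof (cases f)
    case Meet
    show ?thesis
      by (rule two) (use len Meet in \<open>auto simp: filter_cong_def below_mono\<close>)
  next
    case Join
    show ?thesis
      by (rule two) (use len Join in \<open>auto simp: filter_cong_def below_mono\<close>)
  next
    case Mult
    show ?thesis
      by (rule two) (use len Mult in \<open>auto simp: filter_cong_def below_mono\<close>)
  next
    case Imp
    show ?thesis
      by (rule two) (use len Imp in \<open>auto simp: filter_cong_def below_imp\<close>)
  next
    case Unit
    then show ?thesis
      using * by (auto simp: filter_cong_def below_refl)
  next
    case Neg
    then have "length xs = 1" "SIRL A"
      using len S_Neg by auto
    then show ?thesis
      using * Neg by (auto simp: length_Suc_conv list_all2_Cons1 filter_cong_def below_neg)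
  qed
qed

lemma mem_filter_iff_cong:
  assumes "x \<in> N"
  shows "x \<in> F \<longleftrightarrow> (e, x) \<in> filter_cong F"
proof
  assume "x \<in> F"
  then show "(e, x) \<in> filter_cong F"
    using assms cone_filterD(1)[OF F] belowI[of x e x] belowI[of e x e]
    by (simp add: filter_cong_def N_iff)
next
  assume "(e, x) \<in> filter_cong F"
  then have "below F e x"
    by (simp add: filter_cong_def)
  then obtain c where "c \<in> F" "c \<in> M" "c \<odot> e \<sqsubseteq> x"
    by (rule belowE)
  then show "x \<in> F"
    using assms cone_filterD(3)[OF F] by auto
qed

end

lemma filter_cong_restrict:
  assumes F: "cone_filter F" and G: "cone_filter G" and U: "subuniverse S A U" and "F \<inter> U \<subseteq> G"
  shows "filter_cong F \<inter> U \<times> U \<subseteq> filter_cong G"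
proof -
  have "below G x y" if "below F x y" "x \<in> U" "y \<in> U" for x y
  proof -
    have "(x \<leadsto> y) \<sqinter> e \<in> U"
      using that subuniverse_closed(2)[OF U] subuniverse_closed(3,6)[OF U] by simp
    then show ?thesis
      using that assms(4) by (auto simp: below_iff[OF F] below_iff[OF G])
  qed
  then show ?thesis
    by (auto simp: filter_cong_def)
qed

lemma epic_filter_subset:
  assumes "cone_filter F" "cone_filter G" "epic S K A U" "quot A (filter_cong G) \<in> K"
    "rep (filter_cong F) ` U = rep (filter_cong F) ` M" "F \<inter> U \<subseteq> G"
  shows "F \<subseteq> G"
proof
  have "subuniverse S A U"
    using assms(3) by (simp add: epic_def)
  then have "filter_cong F \<subseteq> filter_cong G"
    using assms
    by (intro epic_congruence_subset[OF filter_cong_congruence filter_cong_congruence]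
        filter_cong_restrict) auto
  then show "x \<in> G" if "x \<in> F" for x
    using that mem_filter_iff_cong assms(1,2) cone_filterD(2)[OF assms(1)] by blast
qed

text \<open>For \<open>b \<in> N - U\<close> there are prime filters \<open>F\<close>, \<open>G\<close> with \<open>b \<in> F - G\<close> and \<open>F \<inter> U \<subseteq> G\<close>: first choose
  \<open>G\<close> above the elements of \<open>U\<close> that dominate \<open>b\<close>, then \<open>F\<close> above \<open>b\<close> and disjoint from \<open>U - G\<close>.\<close>

lemma cone_subset_subuniverse:
  assumes U: "subuniverse S A U"
    and order: "\<And>F G. F \<in> P \<Longrightarrow> G \<in> P \<Longrightarrow> F \<inter> U \<subseteq> G \<Longrightarrow> F \<subseteq> G"
  shows "N \<subseteq> U"
proof
  fix b
  assume b: "b \<in> N"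
  show "b \<in> U"
  proof (rule ccontr)
    assume bU: "b \<notin> U"
    define J where "J = {x \<in> N. \<exists>a\<in>U \<inter> N. b \<sqsubseteq> a \<and> a \<sqsubseteq> x}"
    have "cone_filter J"
      unfolding cone_filter_def
    proof (intro conjI ballI impI)
      show "e \<in> J"
        using b subuniverse_closed(2)[OF U] by (auto simp: J_def N_iff)
      show "J \<subseteq> N" by (auto simp: J_def)
    next
      fix x y
      assume "x \<in> J" "y \<in> N" "x \<sqsubseteq> y"
      then show "y \<in> J"
        using leq_trans[of _ x y] by (auto simp: J_def N_iff)
    next
      fix x y
      assume "x \<in> J" "y \<in> J"
      then obtain a a' where a: "a \<in> U" "a \<in> N" "b \<sqsubseteq> a" "a \<sqsubseteq> x" "a' \<in> U" "a' \<in> N" "b \<sqsubseteq> a'" "a' \<sqsubseteq> y"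
        and N: "x \<in> N" "y \<in> N"
        by (auto simp: J_def)
      have "b \<sqsubseteq> a \<odot> a'"
        using a b prod_mono[of b a b a'] idem[of b] by (simp add: N_iff)
      moreover have "a \<odot> a' \<sqsubseteq> x \<odot> y"
        using a N by (simp add: N_iff prod_mono)
      ultimately show "x \<odot> y \<in> J"
        using a N subuniverse_closed(5)[OF U] by (auto simp: J_def)
    qed
    moreover have "{x \<in> N. x \<sqsubseteq> b} \<subseteq> N" by blast
    moreover have "x \<in> {x \<in> N. x \<sqsubseteq> b}" if "x \<in> N" "y \<in> {x \<in> N. x \<sqsubseteq> b}" "x \<sqsubseteq> y" for x y
      using that b leq_trans[of x y b] by (auto simp: N_M)
    moreover have "x \<squnion> y \<in> {x \<in> N. x \<sqsubseteq> b}" if "x \<in> {x \<in> N. x \<sqsubseteq> b}" "y \<in> {x \<in> N. x \<sqsubseteq> b}" for x y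
      using that b by (auto simp: N_M sup_least)
    moreover have "J \<inter> {x \<in> N. x \<sqsubseteq> b} = {}"
    proof -
      have "a = b" if "a \<in> N" "b \<sqsubseteq> a" "a \<sqsubseteq> x" "x \<sqsubseteq> b" "x \<in> N" for a x
        using that b leq_trans[of a x b] by (simp add: N_M leq_antisym)
      then show ?thesis
        using bU by (auto simp: J_def)
    qed
    ultimately obtain G where G: "G \<in> P" "J \<subseteq> G" "G \<inter> {x \<in> N. x \<sqsubseteq> b} = {}"
      by (rule prime_filter_exists)
    have Gp: "\<And>x y. x \<in> N \<Longrightarrow> y \<in> N \<Longrightarrow> x \<squnion> y \<in> G \<Longrightarrow> x \<in> G \<or> y \<in> G"
      using G(1) by (auto simp: prime_filter_iff)
    define I where "I = {x \<in> N. \<exists>a\<in>U \<inter> N. a \<notin> G \<and> x \<sqsubseteq> a}"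
    have "cone_filter {x \<in> N. b \<sqsubseteq> x}"
      unfolding cone_filter_def
    proof (intro conjI ballI impI)
      show "e \<in> {x \<in> N. b \<sqsubseteq> x}" "{x \<in> N. b \<sqsubseteq> x} \<subseteq> N"
        using b by (auto simp: N_iff)
    next
      fix x y
      assume "x \<in> {x \<in> N. b \<sqsubseteq> x}" "y \<in> N" "x \<sqsubseteq> y"
      then show "y \<in> {x \<in> N. b \<sqsubseteq> x}"
        using b leq_trans[of b x y] by (auto simp: N_M)
    next
      fix x y
      assume "x \<in> {x \<in> N. b \<sqsubseteq> x}" "y \<in> {x \<in> N. b \<sqsubseteq> x}"
      then show "x \<odot> y \<in> {x \<in> N. b \<sqsubseteq> x}"
        using b prod_mono[of b x b y] idem[of b] by (auto simp: N_M N_leq)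
    qed
    moreover have "I \<subseteq> N" by (auto simp: I_def)
    moreover have "x \<in> I" if "x \<in> N" "y \<in> I" "x \<sqsubseteq> y" for x y
      using that leq_trans[of x y] by (auto simp: I_def N_M)
    moreover have "x \<squnion> y \<in> I" if xy: "x \<in> I" "y \<in> I" for x y
    proof -
      obtain a a' where a: "a \<in> U" "a \<in> N" "a \<notin> G" "x \<sqsubseteq> a" "a' \<in> U" "a' \<in> N" "a' \<notin> G" "y \<sqsubseteq> a'"
        and N: "x \<in> N" "y \<in> N"
        using xy by (auto simp: I_def)
      have "x \<squnion> y \<sqsubseteq> a \<squnion> a'"
        using a N leq_trans[of x a "a \<squnion> a'"] leq_trans[of y a' "a \<squnion> a'"] by (simp add: N_M sup_least)
      moreover have "a \<squnion> a' \<notin> G" "a \<squnion> a' \<in> U"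
        using a Gp subuniverse_closed(4)[OF U] by blast+
      ultimately show ?thesis
        using a N by (auto simp: I_def)
    qed
    moreover have "{x \<in> N. b \<sqsubseteq> x} \<inter> I = {}"
    proof -
      have False if "x \<in> N" "b \<sqsubseteq> x" "a \<in> U" "a \<in> N" "a \<notin> G" "x \<sqsubseteq> a" for x a
      proof -
        have "b \<sqsubseteq> a"
          using that b leq_trans[of b x a] by (simp add: N_M)
        then have "a \<in> J"
          using that by (auto simp: J_def N_M)
        then show False
          using that G by blast
      qed
      then show ?thesis
        by (auto simp: I_def)
    qed
    ultimately obtain F where F: "F \<in> P" "{x \<in> N. b \<sqsubseteq> x} \<subseteq> F" "F \<inter> I = {}"
      by (rule prime_filter_exists)
    have "F \<subseteq> N"
      using F(1) cone_filterD(2) by (simp add: prime_filter_iff)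
    then have "F \<inter> U \<subseteq> G"
      using F(3) by (fastforce simp: I_def N_M)
    then have "F \<subseteq> G"
      by (rule order[OF F(1) G(1)])
    then have "b \<in> G"
      using F(2) b by (auto simp: N_M)
    then show False
      using G(3) b by (auto simp: N_M)
  qed
qed

lemma nontrivial_congruence_cone:
  assumes \<theta>: "congruence S A \<theta>" and "\<theta> \<noteq> Id_on M"
  obtains u where "u \<in> N" "u \<noteq> e" "(u, e) \<in> \<theta>"
proof -
  have eq: "equiv M \<theta>"
    using \<theta> by (rule congruence_equiv)
  then have refl: "(x, x) \<in> \<theta>" if "x \<in> M" for x
    using that by (auto simp: equiv_def refl_on_def)
  have opn: "(opn A f [x, y], opn A f [x', y']) \<in> \<theta>"
    if "S f = Some 2" "(x, x') \<in> \<theta>" "(y, y') \<in> \<theta>" for f x y x' y'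
    using congruence_opn[OF \<theta>, of f "[x, y]" "[x', y']"] that by simp
  have "Id_on M \<subseteq> \<theta>"
    using refl by auto
  then obtain x y where xy: "(x, y) \<in> \<theta>" "x \<noteq> y"
    using assms(2) congruence_carrier[OF \<theta>] by (metis Id_onI subrelI subset_antisym)
  then have M: "x \<in> M" "y \<in> M"
    using congruence_carrier[OF \<theta>] by blast+
  have yx: "(y, x) \<in> \<theta>"
    using xy(1) eq by (meson equiv_def symD)
  have rel: "((a \<leadsto> b) \<sqinter> e, e) \<in> \<theta>" if "(a, b) \<in> \<theta>" "a \<in> M" "b \<in> M" for a b
  proof -
    have "e \<sqsubseteq> b \<leadsto> b"
      using that by (simp add: residuation[symmetric])
    then have "(b \<leadsto> b) \<sqinter> e = e"
      using that inf_commute[of "b \<leadsto> b" e] by (simp add: le_def)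
    then show ?thesis
      using opn[of Meet "a \<leadsto> b" "b \<leadsto> b" e e] opn[of Imp a b b b] refl that by simp
  qed
  have leq: "a \<sqsubseteq> b" if "(a \<leadsto> b) \<sqinter> e = e" "a \<in> M" "b \<in> M" for a b
  proof -
    have "e \<sqsubseteq> a \<leadsto> b"
      using that inf_commute[of "a \<leadsto> b" e] by (simp add: le_def)
    then show ?thesis
      using that by (simp add: residuation[symmetric])
  qed
  show thesis
  proof (cases "(x \<leadsto> y) \<sqinter> e = e")
    case True
    then have "(y \<leadsto> x) \<sqinter> e \<noteq> e"
      using leq M xy(2) leq_antisym by blast
    then show thesis
      using M rel[OF yx] by (intro that[of "(y \<leadsto> x) \<sqinter> e"]) simp_all
  next
    case False
    then show thesis
      using M rel[OF xy(1)] by (intro that[of "(x \<leadsto> y) \<sqinter> e"]) simp_all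
  qed
qed

lemma FSI_of_prime_unit:
  assumes "{e} \<in> P"
  shows "FSI S A"
  unfolding FSI_def
proof (intro allI impI, rule ccontr)
  fix \<theta> \<phi>
  assume *: "congruence S A \<theta> \<and> congruence S A \<phi> \<and> \<theta> \<inter> \<phi> = Id_on M"
    and no: "\<not> (\<theta> = Id_on M \<or> \<phi> = Id_on M)"
  obtain u where u: "u \<in> N" "u \<noteq> e" "(u, e) \<in> \<theta>"
    using * no by (auto elim: nontrivial_congruence_cone)
  obtain v where v: "v \<in> N" "v \<noteq> e" "(v, e) \<in> \<phi>"
    using * no by (auto elim: nontrivial_congruence_cone)
  have top: "e \<squnion> w = e" "w \<squnion> e = e" if "w \<in> N" for w
    using that leq_iff_sup[of w e] sup_commute[of w e] by (simp_all add: N_iff)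
  have "(v, v) \<in> \<theta>" "(u, u) \<in> \<phi>"
    using * u v by (auto simp: congruence_def equiv_def refl_on_def N_iff)
  then have "(u \<squnion> v, e \<squnion> v) \<in> \<theta>" "(u \<squnion> v, u \<squnion> e) \<in> \<phi>"
    using * u v congruence_opn[of S A \<theta> Join "[u, v]" "[e, v]"]
      congruence_opn[of S A \<phi> Join "[u, v]" "[u, e]"] by simp_all
  then have "(u \<squnion> v, e) \<in> Id_on M"
    using * top u v by auto
  then have "u \<squnion> v \<in> {e}"
    by (simp add: Id_on_iff)
  then show False
    using assms u v by (auto simp: prime_filter_iff)
qed

end

section \<open>Surjective homomorphisms and depth\<close>

lemma (in srl) finite_depth_bound:
  assumes "depth A < \<infinity>"
  obtains m where "\<And>F n. has_chain (neg_cone A) F n \<Longrightarrow> n < m"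
proof -
  obtain k where k: "depth A = enat k"
    using assms by auto
  have "n < Suc k" if "has_chain (neg_cone A) F n" for F n
  proof -
    have "F \<in> P"
      using that by (auto simp: has_chain_def)
    have "enat n \<le> filter_depth (neg_cone A) F"
      unfolding filter_depth_def using that by (intro SUP_upper) simp
    also have "\<dots> \<le> depth A"
      unfolding depth_def brouwerian_depth_def using \<open>F \<in> P\<close> by (rule SUP_upper)
    finally show ?thesis
      using k by simp
  qed
  then show thesis
    by (rule that)
qed

locale rl_surj = rl A S + C: srl C
  for A :: "(rl_op, 'u) algebra" and S and C :: "(rl_op, 'u) algebra" +
  fixes q
  assumes hom: "q \<in> hom S A C" and onto: "q ` M = carrier C"
begin

lemma q_opn:
  "q e = unit C"
  "x \<in> M \<Longrightarrow> y \<in> M \<Longrightarrow> q (x \<sqinter> y) = meet C (q x) (q y)"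
  "x \<in> M \<Longrightarrow> y \<in> M \<Longrightarrow> q (x \<squnion> y) = join C (q x) (q y)"
  "x \<in> M \<Longrightarrow> y \<in> M \<Longrightarrow> q (x \<odot> y) = mult C (q x) (q y)"
  using hom_opn[OF hom, of Unit "[]"] hom_opn[OF hom, of _ "[x, y]"] by simp_all

lemma q_leq: "x \<in> M \<Longrightarrow> y \<in> M \<Longrightarrow> x \<sqsubseteq> y \<Longrightarrow> le C (q x) (q y)"
  using q_opn(2)[of x y] by (simp add: le_def)

lemma q_N: "x \<in> N \<Longrightarrow> q x \<in> C.N"
  using q_leq[of x e] hom_carrier[OF hom, of x] q_opn(1) by (simp add: N_iff C.N_iff)

lemma q_lift_N:
  assumes "u \<in> C.N"
  obtains x where "x \<in> N" "q x = u"
proof -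
  have "u \<in> q ` M"
    using assms onto by (simp add: C.N_iff)
  then obtain z where z: "z \<in> M" "q z = u"
    by auto
  then have "q (z \<sqinter> e) = u"
    using q_opn(1) q_opn(2)[of z e] assms by (simp add: C.N_iff le_def)
  then show thesis
    using z by (intro that[of "z \<sqinter> e"]) simp_all
qed

lemma preimage_prime_filter:
  assumes "H \<in> C.P"
  shows "{x \<in> N. q x \<in> H} \<in> P"
proof -
  have H: "C.cone_filter H" and pr: "\<And>x y. x \<in> C.N \<Longrightarrow> y \<in> C.N \<Longrightarrow> join C x y \<in> H \<Longrightarrow> x \<in> H \<or> y \<in> H"
    using assms by (auto simp: C.prime_filter_iff)
  have "cone_filter {x \<in> N. q x \<in> H}"
    unfolding cone_filter_def
  proof (intro conjI ballI impI)
    show "e \<in> {x \<in> N. q x \<in> H}" "{x \<in> N. q x \<in> H} \<subseteq> N"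
      using q_opn(1) C.cone_filterD(1)[OF H] by auto
  next
    fix x y
    assume "x \<in> {x \<in> N. q x \<in> H}" "y \<in> N" "x \<sqsubseteq> y"
    then show "y \<in> {x \<in> N. q x \<in> H}"
      using C.cone_filterD(3)[OF H, of "q x" "q y"] q_leq[of x y] q_N by (simp add: N_M)
  next
    fix x y
    assume "x \<in> {x \<in> N. q x \<in> H}" "y \<in> {x \<in> N. q x \<in> H}"
    then show "x \<odot> y \<in> {x \<in> N. q x \<in> H}"
      using C.cone_filterD(4)[OF H, of "q x" "q y"] q_opn(4)[of x y] by (simp add: N_M)
  qed
  moreover have "x \<in> {x \<in> N. q x \<in> H} \<or> y \<in> {x \<in> N. q x \<in> H}"
    if "x \<in> N" "y \<in> N" "x \<squnion> y \<in> {x \<in> N. q x \<in> H}" for x y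
    using that pr[of "q x" "q y"] q_N q_opn(3)[of x y] by (simp add: N_M)
  ultimately show ?thesis
    by (simp add: prime_filter_iff)
qed

lemma preimage_strict_mono:
  assumes "H \<subseteq> C.N" "H' \<subseteq> C.N" "H \<subset> H'"
  shows "{x \<in> N. q x \<in> H} \<subset> {x \<in> N. q x \<in> H'}"
proof -
  obtain u where u: "u \<in> H'" "u \<notin> H"
    using assms(3) by blast
  then obtain x where "x \<in> N" "q x = u"
    using assms(2) by (auto elim: q_lift_N)
  then show ?thesis
    using u assms(3) by blast
qed

lemma has_chain_preimage:
  assumes chain: "has_chain (neg_cone C) H n"
    and unit: "{e} \<in> P" and kernel: "{x \<in> N. q x = unit C} \<noteq> {e}"
  shows "has_chain (neg_cone A) {e} (Suc n)"
proof -
  obtain G where G: "G n = C.N" "\<And>i. i \<le> n \<Longrightarrow> G i \<in> C.P" "\<And>i. i < n \<Longrightarrow> G i \<subset> G (Suc i)"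
    using chain unfolding has_chain_def by blast
  define L where "L i = (case i of 0 \<Rightarrow> {e} | Suc j \<Rightarrow> {x \<in> N. q x \<in> G j})" for i
  have GN: "G i \<subseteq> C.N" "unit C \<in> G i" if "i \<le> n" for i
    using G(2)[OF that] C.cone_filterD(1,2) by (auto simp: C.prime_filter_iff)
  have "L i \<in> P" if "i \<le> Suc n" for i
    using that unit preimage_prime_filter G(2) by (auto simp: L_def split: nat.split)
  moreover have "L i \<subset> L (Suc i)" if "i < Suc n" for i
  proof (cases i)
    case 0
    have "{x \<in> N. q x = unit C} \<subseteq> L 1" "e \<in> {x \<in> N. q x = unit C}"
      using GN(2)[of 0] q_opn(1) by (auto simp: L_def)
    then show ?thesis
      using 0 kernel by (auto simp: L_def)
  next
    case (Suc j)
    then show ?thesis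
      using that preimage_strict_mono[of "G j" "G (Suc j)"] G(3)[of j] GN(1)[of j] GN(1)[of "Suc j"]
      by (simp add: L_def)
  qed
  moreover have "L (Suc n) = N"
    using G(1) q_N by (auto simp: L_def)
  moreover have "L 0 = {e}"
    by (simp add: L_def)
  ultimately show ?thesis
    unfolding has_chain_def by (intro exI[of _ L]) simp
qed

lemma prime_unit_image:
  assumes "{x \<in> N. q x = unit C} \<in> P"
  shows "{unit C} \<in> C.P"
proof -
  have "u = unit C \<or> v = unit C" if uv: "u \<in> C.N" "v \<in> C.N" "join C u v = unit C" for u v
  proof -
    obtain x where x: "x \<in> N" "q x = u"
      using uv(1) by (rule q_lift_N)
    obtain y where y: "y \<in> N" "q y = v"
      using uv(2) by (rule q_lift_N)
    have "x \<squnion> y \<in> {x \<in> N. q x = unit C}"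
      using x y uv(3) q_opn(3)[of x y] by (simp add: N_M)
    then have "x \<in> {x \<in> N. q x = unit C} \<or> y \<in> {x \<in> N. q x = unit C}"
      using assms x y by (simp only: prime_filter_iff)
    then show ?thesis
      using x y by auto
  qed
  then show ?thesis
    using C.cone_filter_unit by (auto simp: C.prime_filter_iff)
qed

end

section \<open>Epic subalgebras\<close>

context
  fixes S :: "rl_op signature" and K :: "(rl_op, 'u) algebra set"
  assumes variety: "variety S K"
    and sig: "S = srl_sig \<and> (\<forall>A\<in>K. SRL A) \<or> S = sirl_sig \<and> (\<forall>A\<in>K. SIRL A)"
begin

lemma K_rl: "A \<in> K \<Longrightarrow> rl A S"
  using sig by unfold_locales (auto simp: SIRL_def)

lemma quot_mem_K:
  assumes "A \<in> K" "srl.cone_filter A F"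
  shows "quot A (rl.filter_cong A F) \<in> K"
proof -
  interpret rl A S
    using assms(1) by (rule K_rl)
  have \<theta>: "congruence S A (filter_cong F)"
    using assms(2) by (rule filter_cong_congruence)
  show ?thesis
    using variety_hom_image[OF variety assms(1) quot_is_algebra[OF \<theta> is_algebra_S] rep_hom[OF \<theta>]]
    by (simp add: carrier_quot)
qed

lemma quot_rl_surj:
  assumes "A \<in> K" "srl.cone_filter A F"
  shows "rl_surj A S (quot A (rl.filter_cong A F)) (rep (rl.filter_cong A F))"
    "{x \<in> carrier (neg_cone A). rep (rl.filter_cong A F) x = unit (quot A (rl.filter_cong A F))} = F"
proof -
  interpret rl A S
    using assms(1) by (rule K_rl)
  have \<theta>: "congruence S A (filter_cong F)"
    using assms(2) by (rule filter_cong_congruence)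
  interpret Q: rl "quot A (filter_cong F)" S
    using quot_mem_K[OF assms] by (rule K_rl)
  show "rl_surj A S (quot A (filter_cong F)) (rep (filter_cong F))"
    by unfold_locales (simp_all add: rep_hom[OF \<theta>] carrier_quot)
  have "rep (filter_cong F) x = rep (filter_cong F) e \<longleftrightarrow> x \<in> F" if "x \<in> N" for x
    using mem_filter_iff_cong[OF assms(2) that] rep_eq_iff[OF \<theta>, of e x] that by (auto simp: N_M)
  then show "{x \<in> N. rep (filter_cong F) x = unit (quot A (filter_cong F))} = F"
    using cone_filterD(2)[OF assms(2)] by (auto simp: opn_quot)
qed

lemma epic_prime_unit:
  assumes "\<forall>A\<in>K. FSI S A \<longrightarrow> depth A < \<infinity> \<and> negatively_generated S A"
    and "A \<in> K" "{unit A} \<in> prime_filters (neg_cone A)"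
    and "\<And>F n. has_chain (neg_cone A) F n \<Longrightarrow> n < m"
    and "epic S K A U"
  shows "U = carrier A"
  using assms(2-)
proof (induction m arbitrary: A U)
  case 0
  interpret rl A S
    using 0(1) by (rule K_rl)
  have "has_chain (neg_cone A) N 0"
    using N_mem_P by (auto simp: has_chain_def)
  then show ?case
    using 0(3) by blast
next
  case (Suc m)
  interpret rl A S
    using Suc.prems(1) by (rule K_rl)
  have U: "subuniverse S A U"
    using Suc.prems(4) by (simp add: epic_def)
  have proper: "rep (filter_cong F) ` U = rep (filter_cong F) ` M" if F: "F \<in> P" "F \<noteq> {e}" for F
  proof -
    have cF: "cone_filter F"
      using F(1) by (simp add: prime_filter_iff)
    let ?Q = "quot A (filter_cong F)" and ?q = "rep (filter_cong F)"
    interpret rl_surj A S ?Q ?q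
      using Suc.prems(1) cF by (rule quot_rl_surj(1))
    have kernel: "{x \<in> N. ?q x = unit ?Q} = F"
      using Suc.prems(1) cF by (rule quot_rl_surj(2))
    have "?q ` U = carrier ?Q"
    proof (rule Suc.IH)
      show "?Q \<in> K"
        using Suc.prems(1) cF by (rule quot_mem_K)
      show "{unit ?Q} \<in> prime_filters (neg_cone ?Q)"
        using F(1) kernel by (intro prime_unit_image) simp
      show "n < m" if "has_chain (neg_cone ?Q) H n" for H n
        using Suc.prems(3)[OF has_chain_preimage[OF that Suc.prems(2)]] kernel F(2) by simp
      show "epic S K ?Q (?q ` U)"
        using Suc.prems(4) hom onto by (rule epic_image)
    qed
    then show ?thesis
      by (simp add: carrier_quot)
  qed
  have "N \<subseteq> U"
  proof (rule cone_subset_subuniverse[OF U])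
    fix F G
    assume FG: "F \<in> P" "G \<in> P" "F \<inter> U \<subseteq> G"
    then have c: "cone_filter F" "cone_filter G"
      by (simp_all add: prime_filter_iff)
    show "F \<subseteq> G"
    proof (cases "F = {e}")
      case True
      then show ?thesis
        using cone_filterD(1)[OF c(2)] by simp
    next
      case False
      then show ?thesis
        using epic_filter_subset[OF c Suc.prems(4) quot_mem_K[OF Suc.prems(1) c(2)]] proper FG by blast
    qed
  qed
  then have "generated S A N \<subseteq> U"
    using U by (auto simp: generated_def)
  moreover have "negatively_generated S A"
    using assms(1) Suc.prems(1) FSI_of_prime_unit[OF Suc.prems(2)] by blast
  ultimately show ?case
    using subuniverse_closed(1)[OF U] by (auto simp: negatively_generated_def)
qed

lemma epic_eq_carrier:
  assumes "\<forall>A\<in>K. FSI S A \<longrightarrow> depth A < \<infinity> \<and> negatively_generated S A"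
    and A: "A \<in> K" and epic: "epic S K A U"
  shows "U = carrier A"
proof -
  interpret rl A S
    using A by (rule K_rl)
  have U: "subuniverse S A U"
    using epic by (simp add: epic_def)
  have all: "rep (filter_cong F) ` U = rep (filter_cong F) ` M" if F: "F \<in> P" for F
  proof -
    have cF: "cone_filter F"
      using F by (simp add: prime_filter_iff)
    let ?Q = "quot A (filter_cong F)" and ?q = "rep (filter_cong F)"
    interpret rl_surj A S ?Q ?q
      using A cF by (rule quot_rl_surj(1))
    have QK: "?Q \<in> K"
      using A cF by (rule quot_mem_K)
    interpret Q: rl ?Q S
      using QK by (rule K_rl)
    have unit: "{unit ?Q} \<in> prime_filters (neg_cone ?Q)"
      using F quot_rl_surj(2)[OF A cF] by (intro prime_unit_image) simp
    then have "depth ?Q < \<infinity>"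
      using assms(1) QK Q.FSI_of_prime_unit by blast
    then obtain m where "\<And>H n. has_chain (neg_cone ?Q) H n \<Longrightarrow> n < m"
      using C.finite_depth_bound by blast
    then have "?q ` U = carrier ?Q"
      using epic_prime_unit[OF assms(1) QK unit] epic_image[OF epic hom onto] by blast
    then show ?thesis
      by (simp add: carrier_quot)
  qed
  have NU: "N \<subseteq> U"
  proof (rule cone_subset_subuniverse[OF U])
    fix F G
    assume FG: "F \<in> P" "G \<in> P" "F \<inter> U \<subseteq> G"
    then have c: "cone_filter F" "cone_filter G"
      by (simp_all add: prime_filter_iff)
    then show "F \<subseteq> G"
      using epic_filter_subset[OF c epic quot_mem_K[OF A c(2)]] all FG by blast
  qed
  have "b \<in> U" if b: "b \<in> M" for b
  proof (rule ccontr)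
    assume "b \<notin> U"
    \<comment> \<open>The elements \<open>c\<close> of the cone with \<open>c \<odot> b \<in> U\<close> form an ideal, which meets every prime
      filter and hence contains \<open>e\<close>.\<close>
    define I where "I = {c \<in> N. c \<odot> b \<in> U}"
    have "cone_filter {e}"
      by (rule cone_filter_unit)
    moreover have "I \<subseteq> N"
      by (auto simp: I_def)
    moreover have "x \<in> I" if "x \<in> N" "y \<in> I" "x \<sqsubseteq> y" for x y
    proof -
      have y: "y \<in> N" "y \<odot> b \<in> U"
        using that by (simp_all add: I_def)
      then have "x \<odot> b = x \<odot> (y \<odot> b)"
        using that b prod_absorb[of x y] prod_assoc[of x y b] by (simp add: N_M)
      then show ?thesis
        using that y NU subuniverse_closed(5)[OF U] by (auto simp: I_def)
    qed
    moreover have "x \<squnion> y \<in> I" if "x \<in> I" "y \<in> I" for x y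
    proof -
      have N: "x \<in> N" "y \<in> N" and bU: "x \<odot> b \<in> U" "y \<odot> b \<in> U"
        using that by (simp_all add: I_def)
      have "(x \<squnion> y) \<odot> b = (x \<odot> b) \<squnion> (y \<odot> b)"
        using N b prod_sup_distrib[of x y b] prod_commute[of b] by (simp add: N_M)
      then show ?thesis
        using N bU subuniverse_closed(4)[OF U] by (simp add: I_def)
    qed
    moreover have "{e} \<inter> I = {}"
      using \<open>b \<notin> U\<close> b by (simp add: I_def)
    ultimately obtain F where F: "F \<in> P" "F \<inter> I = {}"
      by (rule prime_filter_exists)
    have cF: "cone_filter F"
      using F(1) by (simp add: prime_filter_iff)
    have "rep (filter_cong F) b \<in> rep (filter_cong F) ` U"
      using all[OF F(1)] b by blast
    then obtain a where a: "a \<in> U" "rep (filter_cong F) b = rep (filter_cong F) a"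
      by auto
    then have aM: "a \<in> M"
      using subuniverse_closed(1)[OF U] by blast
    then have "(b, a) \<in> filter_cong F"
      using a b rep_eq_iff[OF filter_cong_congruence[OF cF]] by blast
    then have "below F b a" "below F a b"
      by (simp_all add: filter_cong_def)
    then obtain c where c: "c \<in> F" "c \<in> N" "c \<in> M" "c \<odot> b \<sqsubseteq> a" "c \<odot> a \<sqsubseteq> b"
      by (rule below_common[OF cF])
    have idem: "c \<odot> (c \<odot> x) = c \<odot> x" if "x \<in> M" for x
      using c that prod_assoc[of c c x] prod_absorb[of c c] by simp
    have "c \<odot> b = c \<odot> a"
      using prod_mono[of c c "c \<odot> b" a] prod_mono[of c c "c \<odot> a" b] c b aM idem
      by (intro leq_antisym) simp_all
    then have "c \<odot> b \<in> U"
      using a c NU subuniverse_closed(5)[OF U] by auto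
    then show False
      using c F(2) by (auto simp: I_def)
  qed
  then show ?thesis
    using subuniverse_closed(1)[OF U] by blast
qed

end

theorem theorem8p1:
  fixes S :: "rl_op signature" and K :: "(rl_op, 'u) algebra set"
  assumes "infinite (UNIV :: 'u set)"
    and "variety S K"
    and "S = srl_sig \<and> (\<forall>A\<in>K. SRL A) \<or> S = sirl_sig \<and> (\<forall>A\<in>K. SIRL A)"
    and "\<forall>A\<in>K. FSI S A \<longrightarrow> depth A < \<infinity> \<and> negatively_generated S A"
  shows "ES_property S K"
  unfolding ES_property_def
proof (intro allI impI)
  fix A B f
  assume epi: "epimorphism S K A B f"
  then have A: "A \<in> K" and B: "B \<in> K" and f: "f \<in> hom S A B"
    by (simp_all add: epimorphism_def)
  have "subuniverse S A (carrier A)"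
    using A assms(2) by (auto simp: variety_def is_algebra_def)
  then have "epic S K B (f ` carrier A)"
    using epi subuniverse_image[OF f] by (simp add: epic_def epimorphism_def)
  then show "f ` carrier A = carrier B"
    by (rule epic_eq_carrier[OF assms(2-4) B])
qed

end
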